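(* Let $\mathcal{C},\mathcal{D},\mathcal{M}$ be categories, let $\mathcal{I}$ be a wide subcategory of $\mathcal{C}$, let $F,G\colon\mathcal{C}\to\mathcal{M}$ be functors, and let $i\colon\mathcal{D}\to\mathcal{C}$ be a functor that is full and $\mathcal{I}$-dense for $F$ and for $G$. Then every natural transformation $(\alpha,t)$ from $F|_{\mathcal{D}}$ to $G|_{\mathcal{D}}$ with a twist on $G|_{\mathcal{D}}$ away from $\mathcal{I}\cap i(\mathcal{D})$ induces a natural transformation $(\bar\alpha,\bar t)$ from $F$ to $G$ with a twist on $G$ away from $\mathcal{I}$ such that the restriction of $(\bar\alpha,\bar t)$ to $i(\mathcal{D})$ is equal to $(\alpha,t)$.
   Context: Here $F|_{\mathcal{D}}$ and $G|_{\mathcal{D}}$ denote the restrictions of $F$ and $G$ to the image $i(\mathcal{D})\subseteq\mathcal{C}$ (a full subcategory, as $i$ is full). Twisted natural transformations. Let $\mathcal{C},\mathcal{M}$ be categories, $\mathcal{I}$ a wide subcategory of $\mathcal{C}$, and $F,G\colon\mathcal{C}\to\mathcal{M}$ functors. A pair $(\alpha,t)$ is a natural transformation from $F$ to $G$ with a twist on $G$ away from $\mathcal{I}$ if to every morphism $f\colon c\to c'$ in $\mathcal{C}$, $\alpha$ assigns a morphism $\alpha(f)\colon F(c)\to G(c')$ and $t$ assigns a morphism $t(f)\colon G(c)\to G(c)$ in $\mathcal{M}$ such that: (i) $\alpha(hgf)=G(h)\,t(h)\,\alpha(g)\,F(f)$ for every ternary composition $hgf$ in $\mathcal{C}$; (ii)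 $t(f)=\mathrm{id}_{G(c)}$ for every morphism $f\colon c\to c'$ in $\mathcal{I}$; (iii) $G(f_1)\,t(g_1)=t(g_2)\,G(f_1)$ for all $f_1,f_2\in\mathcal{I}$ and $g_1,g_2\in\mathcal{C}$ with $f_2g_1=g_2f_1$. Over categories. For an object $c$ of $\mathcal{C}$, $(i/c)$ is the category of pairs $(d,\sigma)$ with $d\in\mathcal{D}$ and $\sigma\colon i(d)\to c$ in $\mathcal{C}$; a morphism $(d_1,\sigma_1)\to(d_2,\sigma_2)$ is a morphism $f\colon d_1\to d_2$ in $\mathcal{D}$ with $\sigma_1=\sigma_2\circ i(f)$. Let $\pi_c\colon(i/c)\to\mathcal{D}$ be the projection. For $f\colon x\to y$ in $\mathcal{C}$, $f_*\colon(i/x)\to(i/y)$ is the induced functor $(d,\sigma)\mapsto(d,f\sigma)$. Let $(i/c)_{\mathcal{I}}$ be the subcategory of $(i/c)$ whose objects are the $(d,\sigma)$ with $\sigma$ in $\mathcal{I}$ and whose morphisms are the morphisms $g$ between such objects with $i(g)$ in $\mathcal{I}$; let $i_c\colon(i/c)_{\mathcal{I}}\to(i/c)$ be the inclusion. Density. $i$ is dense if for every object $c$ of $\mathcal{C}$ the colimit of $i\pi_c$ is naturally isomorphic to $c$; $i$ is dense for $F$ if for every $c$ the morphisms $F(\sigma)\colon F(i(d))\to F(c)$, $(d,\sigma)\in(i/c)$, exhibit $F(c)$ as the colimit of $F i\pi_c$. The functor $i$ is $\mathcal{I}$-dense for $F$ if: (i) $i$ is dense for $F$; (ii) for every object $c$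 of $\mathcal{C}$ there is a retraction functor $r_c\colon(i/c)\to(i/c)_{\mathcal{I}}$ (so $r_ci_c=\mathrm{id}$) with a natural transformation $s$ (in the usual sense) from $1_{(i/c)}$ to $i_cr_c$ which is the identity on $(i/c)_{\mathcal{I}}$; write $s_\sigma$ for its component $(d,\sigma)\to i_cr_c(d,\sigma)$; (iii) for every morphism $f\colon x\to y$ in $\mathcal{C}$ and every object $(d,\sigma)$ of $(i/x)$, the morphism $r_y(f_*(s_\sigma))$ in $(i/y)$ is the identity. "$\mathcal{I}$-dense for $F$ and $G$" means that (i) holds for both $F$ and $G$ and (ii), (iii) hold. *)

theory Defs
  imports Main
begin

section \<open>Categories, functors, natural transformations\<close>

record ('o, 'a) cat =
  Ob :: "'o set"
  Ar :: "'a set"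
  Dom :: "'a \<Rightarrow> 'o"
  Cod :: "'a \<Rightarrow> 'o"
  Ide :: "'o \<Rightarrow> 'a"
  Comp :: "'a \<Rightarrow> 'a \<Rightarrow> 'a" (infixl "\<cdot>\<index>" 70)

definition hom :: "('o, 'a) cat \<Rightarrow> 'o \<Rightarrow> 'o \<Rightarrow> 'a set" where
  "hom C x y = {f \<in> Ar C. Dom C f = x \<and> Cod C f = y}"

text \<open>As usual, \<open>g \<cdot>\<^bsub>C\<^esub> f\<close> is ``first \<open>f\<close>, then \<open>g\<close>''; it is only meaningful
  when \<open>Cod C f = Dom C g\<close>.\<close>

locale category =
  fixes C :: "('o, 'a) cat" (structure)
  assumes Dom_Ob: "f \<in> Ar C \<Longrightarrow> Dom C f \<in> Ob C"
    and Cod_Ob: "f \<in> Ar C \<Longrightarrow> Cod C f \<in> Ob C"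
    and Ide_hom: "x \<in> Ob C \<Longrightarrow> Ide C x \<in> hom C x x"
    and Comp_hom: "\<lbrakk>f \<in> hom C x y; g \<in> hom C y z\<rbrakk> \<Longrightarrow> g \<cdot> f \<in> hom C x z"
    and Comp_Ide: "f \<in> hom C x y \<Longrightarrow> f \<cdot> Ide C x = f"
    and Ide_Comp: "f \<in> hom C x y \<Longrightarrow> Ide C y \<cdot> f = f"
    and Comp_assoc:
      "\<lbrakk>f \<in> hom C w x; g \<in> hom C x y; h \<in> hom C y z\<rbrakk> \<Longrightarrow> h \<cdot> (g \<cdot> f) = h \<cdot> g \<cdot> f"

definition is_identity :: "('o, 'a) cat \<Rightarrow> 'a \<Rightarrow> bool" where
  "is_identity C f \<longleftrightarrow> (\<exists>x\<in>Ob C. f = Ide C x)"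

text \<open>A functor is a pair of total functions which is only inspected on the objects and
  arrows of its source category. Hence the restriction of a functor to a subcategory is
  the same pair of functions, regarded as a functor on the smaller category.\<close>

record ('o1, 'a1, 'o2, 'a2) fctr =
  FOb :: "'o1 \<Rightarrow> 'o2"
  FAr :: "'a1 \<Rightarrow> 'a2"

locale cat_functor = source: category C + target: category D
  for C :: "('o1, 'a1) cat" and D :: "('o2, 'a2) cat" +
  fixes F :: "('o1, 'a1, 'o2, 'a2) fctr"
  assumes FOb_Ob: "x \<in> Ob C \<Longrightarrow> FOb F x \<in> Ob D"
    and FAr_hom: "f \<in> hom C x y \<Longrightarrow> FAr F f \<in> hom D (FOb F x) (FOb F y)"
    and FAr_Ide: "x \<in> Ob C \<Longrightarrow> FAr F (Ide C x) = Ide D (FOb F x)"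
    and FAr_Comp: "\<lbrakk>f \<in> hom C x y; g \<in> hom C y z\<rbrakk>
      \<Longrightarrow> FAr F (g \<cdot>\<^bsub>C\<^esub> f) = FAr F g \<cdot>\<^bsub>D\<^esub> FAr F f"

text \<open>\<open>id_fctr\<close> serves both as identity functor and as inclusion of a subcategory.\<close>

definition id_fctr :: "('o, 'a, 'o, 'a) fctr" where
  "id_fctr = \<lparr>FOb = (\<lambda>x. x), FAr = (\<lambda>f. f)\<rparr>"

definition comp_fctr ::
  "('o2, 'a2, 'o3, 'a3) fctr \<Rightarrow> ('o1, 'a1, 'o2, 'a2) fctr \<Rightarrow> ('o1, 'a1, 'o3, 'a3) fctr"
  (infixl "\<circ>\<^sub>F" 55) where
  "G \<circ>\<^sub>F F = \<lparr>FOb = (\<lambda>x. FOb G (FOb F x)), FAr = (\<lambda>f. FAr G (FAr F f))\<rparr>"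

definition full_functor ::
  "('o1, 'a1) cat \<Rightarrow> ('o2, 'a2) cat \<Rightarrow> ('o1, 'a1, 'o2, 'a2) fctr \<Rightarrow> bool" where
  "full_functor C D F \<longleftrightarrow> cat_functor C D F \<and>
    (\<forall>x\<in>Ob C. \<forall>y\<in>Ob C. \<forall>g\<in>hom D (FOb F x) (FOb F y). \<exists>f\<in>hom C x y. FAr F f = g)"

definition nat_trans ::
  "('o1, 'a1) cat \<Rightarrow> ('o2, 'a2) cat \<Rightarrow> ('o1, 'a1, 'o2, 'a2) fctr
    \<Rightarrow> ('o1, 'a1, 'o2, 'a2) fctr \<Rightarrow> ('o1 \<Rightarrow> 'a2) \<Rightarrow> bool" where
  "nat_trans C D F G \<eta> \<longleftrightarrow>
    (\<forall>x\<in>Ob C. \<eta> x \<in> hom D (FOb F x) (FOb G x)) \<and>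
    (\<forall>f\<in>Ar C. \<eta> (Cod C f) \<cdot>\<^bsub>D\<^esub> FAr F f = FAr G f \<cdot>\<^bsub>D\<^esub> \<eta> (Dom C f))"

definition cocone ::
  "('o1, 'a1) cat \<Rightarrow> ('o2, 'a2) cat \<Rightarrow> ('o1, 'a1, 'o2, 'a2) fctr
    \<Rightarrow> 'o2 \<Rightarrow> ('o1 \<Rightarrow> 'a2) \<Rightarrow> bool" where
  "cocone J M P m \<kappa> \<longleftrightarrow> m \<in> Ob M \<and>
    (\<forall>j\<in>Ob J. \<kappa> j \<in> hom M (FOb P j) m) \<and>
    (\<forall>u\<in>Ar J. \<kappa> (Cod J u) \<cdot>\<^bsub>M\<^esub> FAr P u = \<kappa> (Dom J u))"

definition is_colimit ::
  "('o1, 'a1) cat \<Rightarrow> ('o2, 'a2) cat \<Rightarrow> ('o1, 'a1, 'o2, 'a2) fctr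
    \<Rightarrow> 'o2 \<Rightarrow> ('o1 \<Rightarrow> 'a2) \<Rightarrow> bool" where
  "is_colimit J M P m \<kappa> \<longleftrightarrow> cocone J M P m \<kappa> \<and>
    (\<forall>n \<nu>. cocone J M P n \<nu> \<longrightarrow>
      (\<exists>!u. u \<in> hom M m n \<and> (\<forall>j\<in>Ob J. u \<cdot>\<^bsub>M\<^esub> \<kappa> j = \<nu> j)))"

text \<open>A wide subcategory is represented by its set of arrows.\<close>

definition wide_subcategory :: "('o, 'a) cat \<Rightarrow> 'a set \<Rightarrow> bool" where
  "wide_subcategory C I \<longleftrightarrow> I \<subseteq> Ar C \<and> (\<forall>x\<in>Ob C. Ide C x \<in> I) \<and>
    (\<forall>f\<in>I. \<forall>g\<in>I. Cod C f = Dom C g \<longrightarrow> g \<cdot>\<^bsub>C\<^esub> f \<in> I)"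

text \<open>For a full functor this is a category, namely the full subcategory of \<open>C\<close> on the
  objects \<open>FOb i d\<close>; see \<open>category_image_cat\<close> and \<open>Ar_image_cat\<close> below.\<close>

definition image_cat ::
  "('o1, 'a1) cat \<Rightarrow> ('o2, 'a2) cat \<Rightarrow> ('o1, 'a1, 'o2, 'a2) fctr \<Rightarrow> ('o2, 'a2) cat" where
  "image_cat D C i = C\<lparr>Ob := FOb i ` Ob D, Ar := FAr i ` Ar D\<rparr>"

section \<open>Twisted natural transformations\<close>

definition twisted_nat_trans ::
  "('o1, 'a1) cat \<Rightarrow> ('o2, 'a2) cat \<Rightarrow> 'a1 set \<Rightarrow> ('o1, 'a1, 'o2, 'a2) fctr
    \<Rightarrow> ('o1, 'a1, 'o2, 'a2) fctr \<Rightarrow> ('a1 \<Rightarrow> 'a2) \<Rightarrow> ('a1 \<Rightarrow> 'a2) \<Rightarrow> bool" where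
  "twisted_nat_trans C M I F G \<alpha> t \<longleftrightarrow>
    (\<forall>f\<in>Ar C. \<alpha> f \<in> hom M (FOb F (Dom C f)) (FOb G (Cod C f))) \<and>
    (\<forall>f\<in>Ar C. t f \<in> hom M (FOb G (Dom C f)) (FOb G (Dom C f))) \<and>
    (\<forall>f\<in>Ar C. \<forall>g\<in>Ar C. \<forall>h\<in>Ar C. Cod C f = Dom C g \<and> Cod C g = Dom C h \<longrightarrow>
      \<alpha> (h \<cdot>\<^bsub>C\<^esub> g \<cdot>\<^bsub>C\<^esub> f) = FAr G h \<cdot>\<^bsub>M\<^esub> t h \<cdot>\<^bsub>M\<^esub> \<alpha> g \<cdot>\<^bsub>M\<^esub> FAr F f) \<and>
    (\<forall>f\<in>I. t f = Ide M (FOb G (Dom C f))) \<and>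
    (\<forall>f1\<in>I. \<forall>f2\<in>I. \<forall>g1\<in>Ar C. \<forall>g2\<in>Ar C.
      Cod C g1 = Dom C f2 \<and> Cod C f1 = Dom C g2 \<and> Dom C g1 = Dom C f1 \<and>
      f2 \<cdot>\<^bsub>C\<^esub> g1 = g2 \<cdot>\<^bsub>C\<^esub> f1 \<longrightarrow>
      FAr G f1 \<cdot>\<^bsub>M\<^esub> t g1 = t g2 \<cdot>\<^bsub>M\<^esub> FAr G f1)"

section \<open>Over categories\<close>

text \<open>An arrow \<open>(d1, \<sigma>1) \<rightarrow> (d2, \<sigma>2)\<close> of \<open>(i/c)\<close> is a triple
  \<open>((d1, \<sigma>1), f, (d2, \<sigma>2))\<close>, so that it determines its domain and codomain.\<close>

type_synonym ('do, 'da, 'ca) over_ar = "('do \<times> 'ca) \<times> 'da \<times> ('do \<times> 'ca)"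

definition over_cat ::
  "('do, 'da) cat \<Rightarrow> ('co, 'ca) cat \<Rightarrow> ('do, 'da, 'co, 'ca) fctr \<Rightarrow> 'co
    \<Rightarrow> ('do \<times> 'ca, ('do, 'da, 'ca) over_ar) cat" where
  "over_cat D C i c = \<lparr>
    Ob = {(d, \<sigma>). d \<in> Ob D \<and> \<sigma> \<in> hom C (FOb i d) c},
    Ar = {((d1, \<sigma>1), f, (d2, \<sigma>2)).
            d1 \<in> Ob D \<and> \<sigma>1 \<in> hom C (FOb i d1) c \<and>
            d2 \<in> Ob D \<and> \<sigma>2 \<in> hom C (FOb i d2) c \<and>
            f \<in> hom D d1 d2 \<and> \<sigma>1 = \<sigma>2 \<cdot>\<^bsub>C\<^esub> FAr i f},
    Dom = (\<lambda>(X, f, Y). X),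
    Cod = (\<lambda>(X, f, Y). Y),
    Ide = (\<lambda>X. (X, Ide D (fst X), X)),
    Comp = (\<lambda>(Y', g, Z) (X, f, Y). (X, g \<cdot>\<^bsub>D\<^esub> f, Z))\<rparr>"

definition over_proj :: "('do \<times> 'ca, ('do, 'da, 'ca) over_ar, 'do, 'da) fctr" where
  "over_proj = \<lparr>FOb = fst, FAr = (\<lambda>(X, f, Y). f)\<rparr>"

definition over_push :: "('co, 'ca) cat \<Rightarrow> 'ca \<Rightarrow>
    ('do \<times> 'ca, ('do, 'da, 'ca) over_ar, 'do \<times> 'ca, ('do, 'da, 'ca) over_ar) fctr" where
  "over_push C f = \<lparr>
    FOb = (\<lambda>(d, \<sigma>). (d, f \<cdot>\<^bsub>C\<^esub> \<sigma>)),
    FAr = (\<lambda>((d1, \<sigma>1), g, (d2, \<sigma>2)). ((d1, f \<cdot>\<^bsub>C\<^esub> \<sigma>1), g, (d2, f \<cdot>\<^bsub>C\<^esub> \<sigma>2)))\<rparr>"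

definition over_subcat ::
  "('do, 'da) cat \<Rightarrow> ('co, 'ca) cat \<Rightarrow> 'ca set \<Rightarrow> ('do, 'da, 'co, 'ca) fctr \<Rightarrow> 'co
    \<Rightarrow> ('do \<times> 'ca, ('do, 'da, 'ca) over_ar) cat" where
  "over_subcat D C I i c = (over_cat D C i c)\<lparr>
    Ob := {(d, \<sigma>) \<in> Ob (over_cat D C i c). \<sigma> \<in> I},
    Ar := {((d1, \<sigma>1), g, (d2, \<sigma>2)) \<in> Ar (over_cat D C i c).
             \<sigma>1 \<in> I \<and> \<sigma>2 \<in> I \<and> FAr i g \<in> I}\<rparr>"

section \<open>Density\<close>

definition dense_for ::
  "('do, 'da) cat \<Rightarrow> ('co, 'ca) cat \<Rightarrow> ('mo, 'ma) cat \<Rightarrow> ('do, 'da, 'co, 'ca) fctr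
    \<Rightarrow> ('co, 'ca, 'mo, 'ma) fctr \<Rightarrow> bool" where
  "dense_for D C M i F \<longleftrightarrow>
    (\<forall>c\<in>Ob C. is_colimit (over_cat D C i c) M (F \<circ>\<^sub>F i \<circ>\<^sub>F over_proj) (FOb F c)
      (\<lambda>(d, \<sigma>). FAr F \<sigma>))"

definition is_retraction ::
  "('do, 'da) cat \<Rightarrow> ('co, 'ca) cat \<Rightarrow> 'ca set \<Rightarrow> ('do, 'da, 'co, 'ca) fctr \<Rightarrow> 'co
    \<Rightarrow> ('do \<times> 'ca, ('do, 'da, 'ca) over_ar, 'do \<times> 'ca, ('do, 'da, 'ca) over_ar) fctr
    \<Rightarrow> bool" where
  "is_retraction D C I i c r \<longleftrightarrow>
    cat_functor (over_cat D C i c) (over_subcat D C I i c) r \<and>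
    (\<forall>X\<in>Ob (over_subcat D C I i c). FOb r X = X) \<and>
    (\<forall>u\<in>Ar (over_subcat D C I i c). FAr r u = u)"

text \<open>The retractions \<open>r c\<close> and the transformations \<open>s c\<close> are chosen for all \<open>c\<close>
  simultaneously, since the last condition relates those at the domain and the codomain
  of \<open>f\<close>.\<close>

definition I_dense_for ::
  "('do, 'da) cat \<Rightarrow> ('co, 'ca) cat \<Rightarrow> ('mo, 'ma) cat \<Rightarrow> 'ca set
    \<Rightarrow> ('do, 'da, 'co, 'ca) fctr \<Rightarrow> ('co, 'ca, 'mo, 'ma) fctr \<Rightarrow> bool" where
  "I_dense_for D C M I i F \<longleftrightarrow> dense_for D C M i F \<and>
    (\<exists>r s.
      (\<forall>c\<in>Ob C. is_retraction D C I i c (r c) \<and>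
        nat_trans (over_cat D C i c) (over_cat D C i c) id_fctr (id_fctr \<circ>\<^sub>F r c) (s c) \<and>
        (\<forall>X\<in>Ob (over_subcat D C I i c). s c X = Ide (over_cat D C i c) X)) \<and>
      (\<forall>x\<in>Ob C. \<forall>y\<in>Ob C. \<forall>f\<in>hom C x y. \<forall>X\<in>Ob (over_cat D C i x).
        is_identity (over_cat D C i y) (FAr (r y) (FAr (over_push C f) (s x X)))))"

section \<open>Well-formedness of the constructions\<close>

lemma Ar_image_cat:
  assumes "full_functor D C i"
  shows "Ar (image_cat D C i) =
    {f \<in> Ar C. Dom C f \<in> FOb i ` Ob D \<and> Cod C f \<in> FOb i ` Ob D}"
proof -
  interpret i: cat_functor D C i using assms by (simp add: full_functor_def)
  have 1: "FAr i g \<in> Ar C \<and> Dom C (FAr i g) = FOb i (Dom D g) \<and> Cod C (FAr i g) = FOb i (Cod D g)"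
    if "g \<in> Ar D" for g
    using i.FAr_hom[of g "Dom D g" "Cod D g"] that by (simp add: hom_def)
  have 2: "f \<in> FAr i ` Ar D" if "f \<in> Ar C" "Dom C f = FOb i x" "Cod C f = FOb i y"
    and xy: "x \<in> Ob D" "y \<in> Ob D" for f x y
  proof -
    have "f \<in> hom C (FOb i x) (FOb i y)" using that by (simp add: hom_def)
    then obtain g where "g \<in> hom D x y" "FAr i g = f"
      using assms xy unfolding full_functor_def by blast
    then show ?thesis by (auto simp: hom_def)
  qed
  show ?thesis
    using 1 2 i.source.Dom_Ob i.source.Cod_Ob by (auto simp: image_cat_def)
qed

lemma category_image_cat:
  assumes "full_functor D C i"
  shows "category (image_cat D C i)"
proof -
  interpret i: cat_functor D C i using assms by (simp add: full_functor_def)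
  have hom: "hom (image_cat D C i) x y =
      (if x \<in> FOb i ` Ob D \<and> y \<in> FOb i ` Ob D then hom C x y else {})" for x y
    unfolding hom_def Ar_image_cat[OF assms] by (auto simp: image_cat_def)
  have sel: "Ob (image_cat D C i) = FOb i ` Ob D" "Dom (image_cat D C i) = Dom C"
    "Cod (image_cat D C i) = Cod C" "Ide (image_cat D C i) = Ide C"
    "Comp (image_cat D C i) = Comp C"
    by (simp_all add: image_cat_def)
  show ?thesis
  proof (unfold_locales, goal_cases)
    case (1 f) then show ?case unfolding Ar_image_cat[OF assms] sel by auto
  next
    case (2 f) then show ?case unfolding Ar_image_cat[OF assms] sel by auto
  next
    case (3 x) then show ?case
      unfolding hom sel using i.target.Ide_hom i.FOb_Ob by auto
  next
    case (4 f x y g z) then show ?case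
      unfolding hom sel using i.target.Comp_hom[of f x y g z] by (auto split: if_splits)
  next
    case (5 f x y) then show ?case
      unfolding hom sel using i.target.Comp_Ide by (auto split: if_splits)
  next
    case (6 f x y) then show ?case
      unfolding hom sel using i.target.Ide_Comp by (auto split: if_splits)
  next
    case (7 f w x g y h z) then show ?case
      unfolding hom sel using i.target.Comp_assoc[of f w x g y h z] by (auto split: if_splits)
  qed
qed

lemma category_over_cat:
  assumes "cat_functor D C i"
  shows "category (over_cat D C i c)"
proof -
  interpret i: cat_functor D C i by fact
  have comp: "\<sigma> \<cdot>\<^bsub>C\<^esub> FAr i (g \<cdot>\<^bsub>D\<^esub> f) = \<sigma> \<cdot>\<^bsub>C\<^esub> FAr i g \<cdot>\<^bsub>C\<^esub> FAr i f"
    if "f \<in> hom D x y" "g \<in> hom D y z" "\<sigma> \<in> hom C (FOb i z) c" for f g \<sigma> x y z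
    using i.FAr_Comp[OF that(1,2)]
      i.target.Comp_assoc[OF i.FAr_hom[OF that(1)] i.FAr_hom[OF that(2)] that(3)] by simp
  have ide: "\<sigma> = \<sigma> \<cdot>\<^bsub>C\<^esub> FAr i (Ide D d)" if "d \<in> Ob D" "\<sigma> \<in> hom C (FOb i d) c" for \<sigma> d
    using i.FAr_Ide[OF that(1)] i.target.Comp_Ide[OF that(2)] by simp
  let ?O = "over_cat D C i c"
  have hom: "u \<in> hom ?O X Y \<longleftrightarrow> (\<exists>d1 \<sigma>1 f d2 \<sigma>2. X = (d1, \<sigma>1) \<and> Y = (d2, \<sigma>2) \<and> u = (X, f, Y) \<and>
      d1 \<in> Ob D \<and> \<sigma>1 \<in> hom C (FOb i d1) c \<and> d2 \<in> Ob D \<and> \<sigma>2 \<in> hom C (FOb i d2) c \<and>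
      f \<in> hom D d1 d2 \<and> \<sigma>1 = \<sigma>2 \<cdot>\<^bsub>C\<^esub> FAr i f)" for u X Y
    unfolding hom_def[of ?O] by (auto simp: over_cat_def)
  have sel: "Ide ?O X = (X, Ide D (fst X), X)" "(Y', g, Z) \<cdot>\<^bsub>?O\<^esub> (X, f, Y) = (X, g \<cdot>\<^bsub>D\<^esub> f, Z)"
    for X Y Y' Z f g
    by (simp_all add: over_cat_def)
  show ?thesis
  proof (unfold_locales, goal_cases)
    case (1 f) then show ?case by (auto simp: over_cat_def)
  next
    case (2 f) then show ?case by (auto simp: over_cat_def)
  next
    case (3 x)
    then obtain d \<sigma> where "x = (d, \<sigma>)" "d \<in> Ob D" "\<sigma> \<in> hom C (FOb i d) c"
      by (auto simp: over_cat_def)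
    then show ?case
      unfolding hom sel using i.source.Ide_hom ide by auto
  next
    case (4 f x y g z) then show ?case
      unfolding hom
      by (elim exE conjE) (use comp i.source.Comp_hom in \<open>fastforce simp: sel\<close>)
  next
    case (5 f x y) then show ?case
      unfolding hom using i.source.Comp_Ide by (auto simp: sel)
  next
    case (6 f x y) then show ?case
      unfolding hom using i.source.Ide_Comp by (auto simp: sel)
  next
    case (7 f w x g y h z) then show ?case
      unfolding hom using i.source.Comp_assoc by (auto simp: sel)
  qed
qed

lemma category_over_subcat:
  assumes i: "cat_functor D C i" and I: "wide_subcategory C I"
  shows "category (over_subcat D C I i c)"
proof -
  interpret i: cat_functor D C i by fact
  interpret O: category "over_cat D C i c" using i by (rule category_over_cat)
  let ?O = "over_cat D C i c" and ?S = "over_subcat D C I i c"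
  have hom: "u \<in> hom ?S X Y \<longleftrightarrow>
      u \<in> hom ?O X Y \<and> snd X \<in> I \<and> snd Y \<in> I \<and> FAr i (fst (snd u)) \<in> I" for u X Y
    unfolding hom_def by (auto simp: over_subcat_def over_cat_def)
  have sel: "Ob ?S = {X \<in> Ob ?O. snd X \<in> I}" "Dom ?S = Dom ?O" "Cod ?S = Cod ?O"
    "Ide ?S = Ide ?O" "Comp ?S = Comp ?O"
    by (auto simp: over_subcat_def)
  have I': "FAr i (g \<cdot>\<^bsub>D\<^esub> f) \<in> I"
    if "f \<in> hom D x y" "g \<in> hom D y z" "FAr i f \<in> I" "FAr i g \<in> I" for f g x y z
    using I that i.FAr_Comp[OF that(1,2)] i.FAr_hom[OF that(1)] i.FAr_hom[OF that(2)]
    unfolding wide_subcategory_def by (auto simp: hom_def)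
  show ?thesis
  proof (unfold_locales, goal_cases)
    case (1 f) then show ?case by (auto simp: over_subcat_def over_cat_def)
  next
    case (2 f) then show ?case by (auto simp: over_subcat_def over_cat_def)
  next
    case (3 x)
    then have "fst x \<in> Ob D" by (auto simp: sel over_cat_def)
    then have "FAr i (Ide D (fst x)) \<in> I"
      using i.FAr_Ide i.FOb_Ob I by (simp add: wide_subcategory_def)
    then show ?case
      using 3 O.Ide_hom unfolding hom by (auto simp: sel over_cat_def)
  next
    case (4 f x y g z)
    then have "FAr i (fst (snd (g \<cdot>\<^bsub>?O\<^esub> f))) \<in> I"
      unfolding hom by (auto simp: over_cat_def hom_def[of "\<lparr>Ob = _, Ar = _, Dom = _, Cod = _, Ide = _, Comp = _\<rparr>"] intro: I')
    then show ?case
      using 4 O.Comp_hom unfolding hom sel by blast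
  next
    case (5 f x y) then show ?case
      unfolding hom sel using O.Comp_Ide by blast
  next
    case (6 f x y) then show ?case
      unfolding hom sel using O.Ide_Comp by blast
  next
    case (7 f w x g y h z) then show ?case
      unfolding hom sel using O.Comp_assoc by blast
  qed
qed

lemma cat_functor_over_push:
  assumes i: "cat_functor D C i" and f: "f \<in> hom C x y"
  shows "cat_functor (over_cat D C i x) (over_cat D C i y) (over_push C f)"
proof -
  interpret i: cat_functor D C i by fact
  interpret X: category "over_cat D C i x" using i by (rule category_over_cat)
  interpret Y: category "over_cat D C i y" using i by (rule category_over_cat)
  have assoc: "f \<cdot>\<^bsub>C\<^esub> (\<sigma> \<cdot>\<^bsub>C\<^esub> FAr i g) = f \<cdot>\<^bsub>C\<^esub> \<sigma> \<cdot>\<^bsub>C\<^esub> FAr i g"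
    if "g \<in> hom D d e" "\<sigma> \<in> hom C (FOb i e) x" for g d e \<sigma>
    using i.target.Comp_assoc[OF i.FAr_hom[OF that(1)] that(2) f] .
  have hom: "u \<in> hom (over_cat D C i c) X Y \<longleftrightarrow>
      (\<exists>d1 \<sigma>1 f d2 \<sigma>2. X = (d1, \<sigma>1) \<and> Y = (d2, \<sigma>2) \<and> u = (X, f, Y) \<and>
      d1 \<in> Ob D \<and> \<sigma>1 \<in> hom C (FOb i d1) c \<and> d2 \<in> Ob D \<and> \<sigma>2 \<in> hom C (FOb i d2) c \<and>
      f \<in> hom D d1 d2 \<and> \<sigma>1 = \<sigma>2 \<cdot>\<^bsub>C\<^esub> FAr i f)" for u X Y c
    unfolding hom_def[of "over_cat D C i c"] by (auto simp: over_cat_def)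
  show ?thesis
  proof (unfold_locales, goal_cases)
    case (1 X) then show ?case
      using i.target.Comp_hom[OF _ f] by (auto simp: over_cat_def over_push_def)
  next
    case (2 u X Y) then show ?case
      unfolding hom
      by (elim exE conjE) (hypsubst, simp add: over_push_def assoc i.target.Comp_hom[OF _ f] flip: assoc)
  next
    case (3 X) then show ?case by (auto simp: over_cat_def over_push_def)
  next
    case (4 u X Y v Z) then show ?case
      unfolding hom by (auto simp: over_cat_def over_push_def)
  qed
qed

end

theory Submission
  imports Defs
begin

text \<open>
Because \<open>t\<close> is trivial on identities, a twisted natural transformation is the same thing
as a family of components \<open>a c = \<alpha> (Ide C c)\<close> together with a twist satisfying
\<open>a y \<cdot> F f = G f \<cdot> t f \<cdot> a x\<close> for \<open>f : x \<rightarrow> y\<close> and the two axioms on \<open>t\<close>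
(\<open>twisted_precompose\<close>, \<open>twisted_postcompose\<close>, \<open>twisted_nat_transI_components\<close>).
So it suffices to extend the components and the twist.

The retractions and the transformations \<open>s\<close> amount to a chosen factorization
\<open>\<sigma> = rgt \<sigma> \<cdot> lft \<sigma>\<close> of every \<open>\<sigma> : i d \<rightarrow> c\<close> through an object \<open>i (mid \<sigma>)\<close>, with
\<open>rgt \<sigma>\<close> in \<open>I\<close> and \<open>lft \<sigma>\<close> in the image of \<open>i\<close>; it is trivial for \<open>\<sigma>\<close> in \<open>I\<close>,
natural in \<open>(d, \<sigma>)\<close> with comparison arrows in \<open>I\<close>, and compatible with pushing forward along
\<open>f\<close> (locale \<open>over_factorization\<close>).

The axioms leave no choice for the extension. With \<open>i d\<close> in the image and \<open>\<sigma>\<close> in \<open>I\<close>,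
naturality gives \<open>a c \<cdot> F \<sigma> = G \<sigma> \<cdot> \<alpha> (Ide C (i d))\<close>. The square with sides \<open>\<sigma>\<close>,
\<open>f\<close>, \<open>lft (f \<cdot> \<sigma>)\<close> and \<open>rgt (f \<cdot> \<sigma>)\<close> gives
\<open>t f \<cdot> G \<sigma> = G \<sigma> \<cdot> t (lft (f \<cdot> \<sigma>))\<close>. Factoring an arbitrary \<open>\<sigma>\<close>, this becomes
  \<open>a c \<cdot> F \<sigma> = G (rgt \<sigma>) \<cdot> \<alpha> (lft \<sigma>)\<close> and
  \<open>t f \<cdot> G \<sigma> = G (rgt \<sigma>) \<cdot> t (lft (f \<cdot> rgt \<sigma>)) \<cdot> G (lft \<sigma>)\<close>.
The right-hand sides are cocones (\<open>component_cocone\<close>, \<open>twist_cocone\<close>), because the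
comparison arrows lie in \<open>I\<close>: there the given twist is trivial and slides along squares. By
density they define \<open>component c\<close> and \<open>twist f\<close>. Density also reduces each axiom to an
equation after composing with \<open>F \<sigma>\<close> or \<open>G \<sigma>\<close>. For naturality
(\<open>component_natural\<close>) the point is that factoring \<open>\<sigma>\<close> first and then \<open>f \<cdot> rgt \<sigma>\<close> gives
the factorization of \<open>f \<cdot> \<sigma>\<close>; for the squares (\<open>twist_square\<close>) it is that
\<open>lft (f \<cdot> \<sigma>) = lft \<sigma>\<close> when \<open>f\<close> is in \<open>I\<close> (\<open>lft_push_I\<close>).\<close>

section \<open>Composable arrows\<close>

context category
begin

text \<open>The axioms of a category in terms of arrows, domains and codomains instead of hom-sets:
all side conditions are then free of extra variables, so that the simplifier can normalize
composites by itself.\<close>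

lemma Comp_Ar: "\<lbrakk>f \<in> Ar C; g \<in> Ar C; Cod C f = Dom C g\<rbrakk> \<Longrightarrow> g \<cdot> f \<in> Ar C"
  and Dom_Comp: "\<lbrakk>f \<in> Ar C; g \<in> Ar C; Cod C f = Dom C g\<rbrakk> \<Longrightarrow> Dom C (g \<cdot> f) = Dom C f"
  and Cod_Comp: "\<lbrakk>f \<in> Ar C; g \<in> Ar C; Cod C f = Dom C g\<rbrakk> \<Longrightarrow> Cod C (g \<cdot> f) = Cod C g"
  using Comp_hom[of f "Dom C f" "Cod C f" g "Cod C g"] by (auto simp: hom_def)

lemma Comp_Ide_Dom: "f \<in> Ar C \<Longrightarrow> x = Dom C f \<Longrightarrow> f \<cdot> Ide C x = f"
  and Ide_Cod_Comp: "f \<in> Ar C \<Longrightarrow> y = Cod C f \<Longrightarrow> Ide C y \<cdot> f = f"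
  using Comp_Ide[of f "Dom C f" "Cod C f"] Ide_Comp[of f "Dom C f" "Cod C f"]
  by (auto simp: hom_def)

lemma Ide_Ar: "x \<in> Ob C \<Longrightarrow> Ide C x \<in> Ar C"
  and Dom_Ide: "x \<in> Ob C \<Longrightarrow> Dom C (Ide C x) = x"
  and Cod_Ide: "x \<in> Ob C \<Longrightarrow> Cod C (Ide C x) = x"
  using Ide_hom[of x] by (auto simp: hom_def)

lemma Comp_assoc_right:
  "\<lbrakk>f \<in> Ar C; g \<in> Ar C; h \<in> Ar C; Cod C f = Dom C g; Cod C g = Dom C h\<rbrakk>
    \<Longrightarrow> h \<cdot> g \<cdot> f = h \<cdot> (g \<cdot> f)"
  using Comp_assoc[of f "Dom C f" "Cod C f" g "Cod C g" h "Cod C h"] by (auto simp: hom_def)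

lemmas arrow_simps = Comp_Ar Dom_Comp Cod_Comp Comp_Ide_Dom Ide_Cod_Comp Ide_Ar Dom_Ide Cod_Ide
  Dom_Ob Cod_Ob Comp_assoc_right

end

context cat_functor
begin

lemma FAr_Ar: "f \<in> Ar C \<Longrightarrow> FAr F f \<in> Ar D"
  and Dom_FAr: "f \<in> Ar C \<Longrightarrow> Dom D (FAr F f) = FOb F (Dom C f)"
  and Cod_FAr: "f \<in> Ar C \<Longrightarrow> Cod D (FAr F f) = FOb F (Cod C f)"
  using FAr_hom[of f "Dom C f" "Cod C f"] by (auto simp: hom_def)

lemma FAr_Comp_Ar:
  "\<lbrakk>f \<in> Ar C; g \<in> Ar C; Cod C f = Dom C g\<rbrakk> \<Longrightarrow> FAr F (g \<cdot>\<^bsub>C\<^esub> f) = FAr F g \<cdot>\<^bsub>D\<^esub> FAr F f"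
  using FAr_Comp[of f "Dom C f" "Cod C f" g "Cod C g"] by (auto simp: hom_def)

lemmas fctr_simps = FAr_Ar Dom_FAr Cod_FAr FAr_Comp_Ar FOb_Ob FAr_Ide

end

lemma image_cat_simps [simp]:
  "Ob (image_cat D C i) = FOb i ` Ob D" "Dom (image_cat D C i) = Dom C"
  "Cod (image_cat D C i) = Cod C" "Ide (image_cat D C i) = Ide C"
  "Comp (image_cat D C i) = Comp C"
  by (simp_all add: image_cat_def)

lemma cat_functor_image_cat:
  assumes i: "full_functor D C i" and F: "cat_functor C M F"
  shows "cat_functor (image_cat D C i) M F"
proof -
  interpret i: cat_functor D C i using i by (simp add: full_functor_def)
  interpret B: category "image_cat D C i" using i by (rule category_image_cat)
  interpret F: cat_functor C M F by fact
  show ?thesis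
    by unfold_locales
      (auto simp: hom_def Ar_image_cat[OF i] i.FOb_Ob F.fctr_simps)
qed

lemma wide_subcategory_image_cat:
  assumes i: "full_functor D C i" and I: "wide_subcategory C I"
  shows "wide_subcategory (image_cat D C i) (I \<inter> Ar (image_cat D C i))"
proof -
  interpret i: cat_functor D C i using i by (simp add: full_functor_def)
  interpret B: category "image_cat D C i" using i by (rule category_image_cat)
  show ?thesis
    using I B.Ide_Ar B.Comp_Ar i.FOb_Ob
    unfolding wide_subcategory_def by auto
qed

section \<open>Twisted natural transformations by components\<close>

text \<open>Both rules come from the ternary axiom by making an outer arrow, respectively the innermost
one, an identity; the twist of an identity is an identity since a wide subcategory contains all
of them.\<close>

lemma
  assumes C: "category C" and I: "wide_subcategory C I"
    and F: "cat_functor C M F" and G: "cat_functor C M G"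
    and tw: "twisted_nat_trans C M I F G \<alpha> t"
    and fg: "f \<in> Ar C" "g \<in> Ar C" "Cod C f = Dom C g"
  shows twisted_precompose: "\<alpha> (g \<cdot>\<^bsub>C\<^esub> f) = \<alpha> g \<cdot>\<^bsub>M\<^esub> FAr F f"
    and twisted_postcompose: "\<alpha> (g \<cdot>\<^bsub>C\<^esub> f) = FAr G g \<cdot>\<^bsub>M\<^esub> t g \<cdot>\<^bsub>M\<^esub> \<alpha> f"
proof -
  interpret F: cat_functor C M F by fact
  interpret G: cat_functor C M G by fact
  note s = F.source.arrow_simps F.target.arrow_simps F.fctr_simps G.fctr_simps
  have ternary: "\<alpha> (h \<cdot>\<^bsub>C\<^esub> g \<cdot>\<^bsub>C\<^esub> f) = FAr G h \<cdot>\<^bsub>M\<^esub> t h \<cdot>\<^bsub>M\<^esub> \<alpha> g \<cdot>\<^bsub>M\<^esub> FAr F f"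
    if "f \<in> Ar C" "g \<in> Ar C" "h \<in> Ar C" "Cod C f = Dom C g" "Cod C g = Dom C h" for f g h
    using tw that unfolding twisted_nat_trans_def by blast
  have hom: "\<alpha> f \<in> hom M (FOb F (Dom C f)) (FOb G (Cod C f))"
      "t f \<in> hom M (FOb G (Dom C f)) (FOb G (Dom C f))" if "f \<in> Ar C" for f
    using tw that unfolding twisted_nat_trans_def by blast+
  have tI: "t (Ide C x) = Ide M (FOb G x)" if "x \<in> Ob C" for x
  proof -
    have "Ide C x \<in> I" using I that by (auto simp: wide_subcategory_def)
    then show ?thesis using tw that F.source.Dom_Ide[OF that] by (simp add: twisted_nat_trans_def)
  qed
  note h = hom[OF fg(1)] hom[OF fg(2)]
  show "\<alpha> (g \<cdot>\<^bsub>C\<^esub> f) = \<alpha> g \<cdot>\<^bsub>M\<^esub> FAr F f"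
    using ternary[of f g "Ide C (Cod C g)"] fg h by (simp add: s hom_def tI)
  show "\<alpha> (g \<cdot>\<^bsub>C\<^esub> f) = FAr G g \<cdot>\<^bsub>M\<^esub> t g \<cdot>\<^bsub>M\<^esub> \<alpha> f"
    using ternary[of "Ide C (Dom C f)" f g] fg h by (simp add: s hom_def tI)
qed

text \<open>The ternary axiom follows from naturality of the components at the last arrow \<open>h\<close> alone:
\<open>a \<cdot> F (h \<cdot> g \<cdot> f) = (a \<cdot> F h) \<cdot> F g \<cdot> F f = (G h \<cdot> t h \<cdot> a) \<cdot> F g \<cdot> F f\<close>.\<close>

lemma twisted_nat_transI_components:
  assumes F: "cat_functor C M F" and G: "cat_functor C M G"
    and a: "\<And>c. c \<in> Ob C \<Longrightarrow> a c \<in> hom M (FOb F c) (FOb G c)"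
    and t: "\<And>f. f \<in> Ar C \<Longrightarrow> t f \<in> hom M (FOb G (Dom C f)) (FOb G (Dom C f))"
    and natural: "\<And>f. f \<in> Ar C \<Longrightarrow>
      a (Cod C f) \<cdot>\<^bsub>M\<^esub> FAr F f = FAr G f \<cdot>\<^bsub>M\<^esub> t f \<cdot>\<^bsub>M\<^esub> a (Dom C f)"
    and t_I: "\<And>f. f \<in> I \<Longrightarrow> t f = Ide M (FOb G (Dom C f))"
    and square: "\<And>f1 f2 g1 g2. \<lbrakk>f1 \<in> I; f2 \<in> I; g1 \<in> Ar C; g2 \<in> Ar C; Cod C g1 = Dom C f2;
      Cod C f1 = Dom C g2; Dom C g1 = Dom C f1; f2 \<cdot>\<^bsub>C\<^esub> g1 = g2 \<cdot>\<^bsub>C\<^esub> f1\<rbrakk>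
      \<Longrightarrow> FAr G f1 \<cdot>\<^bsub>M\<^esub> t g1 = t g2 \<cdot>\<^bsub>M\<^esub> FAr G f1"
  shows "twisted_nat_trans C M I F G (\<lambda>f. a (Cod C f) \<cdot>\<^bsub>M\<^esub> FAr F f) t"
proof -
  interpret F: cat_functor C M F by fact
  interpret G: cat_functor C M G by fact
  note s = F.source.arrow_simps F.target.arrow_simps F.fctr_simps G.fctr_simps
  have ternary: "a (Cod C (h \<cdot>\<^bsub>C\<^esub> g \<cdot>\<^bsub>C\<^esub> f)) \<cdot>\<^bsub>M\<^esub> FAr F (h \<cdot>\<^bsub>C\<^esub> g \<cdot>\<^bsub>C\<^esub> f)
      = FAr G h \<cdot>\<^bsub>M\<^esub> t h \<cdot>\<^bsub>M\<^esub> (a (Cod C g) \<cdot>\<^bsub>M\<^esub> FAr F g) \<cdot>\<^bsub>M\<^esub> FAr F f"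
    if fgh: "f \<in> Ar C" "g \<in> Ar C" "h \<in> Ar C" "Cod C f = Dom C g" "Cod C g = Dom C h" for f g h
  proof -
    have m: "a (Cod C h) \<in> hom M (FOb F (Cod C h)) (FOb G (Cod C h))"
        "a (Dom C h) \<in> hom M (FOb F (Dom C h)) (FOb G (Dom C h))"
        "t h \<in> hom M (FOb G (Dom C h)) (FOb G (Dom C h))"
      using fgh a t F.source.Cod_Ob F.source.Dom_Ob by simp_all
    have "a (Cod C (h \<cdot>\<^bsub>C\<^esub> g \<cdot>\<^bsub>C\<^esub> f)) \<cdot>\<^bsub>M\<^esub> FAr F (h \<cdot>\<^bsub>C\<^esub> g \<cdot>\<^bsub>C\<^esub> f)
        = a (Cod C h) \<cdot>\<^bsub>M\<^esub> FAr F h \<cdot>\<^bsub>M\<^esub> (FAr F g \<cdot>\<^bsub>M\<^esub> FAr F f)"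
      using fgh m by (simp add: s hom_def)
    also have "\<dots> = FAr G h \<cdot>\<^bsub>M\<^esub> t h \<cdot>\<^bsub>M\<^esub> (a (Cod C g) \<cdot>\<^bsub>M\<^esub> FAr F g) \<cdot>\<^bsub>M\<^esub> FAr F f"
      unfolding natural[OF fgh(3)] using fgh m by (simp add: s hom_def)
    finally show ?thesis .
  qed
  show ?thesis
    unfolding twisted_nat_trans_def
  proof (intro conjI ballI impI)
    fix f assume "f \<in> Ar C"
    then show "a (Cod C f) \<cdot>\<^bsub>M\<^esub> FAr F f \<in> hom M (FOb F (Dom C f)) (FOb G (Cod C f))"
      using a[of "Cod C f"] by (simp add: s hom_def)
  qed (use t t_I square ternary in \<open>blast+\<close>)
qed

section \<open>Testing arrows on a dense subcategory\<close>

lemma over_cat_sel: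
  "Ob (over_cat D C i c) = {(d, \<sigma>). d \<in> Ob D \<and> \<sigma> \<in> hom C (FOb i d) c}"
  "Dom (over_cat D C i c) (X, f, Y) = X"
  "Cod (over_cat D C i c) (X, f, Y) = Y"
  "Ide (over_cat D C i c) X = (X, Ide D (fst X), X)"
  "Comp (over_cat D C i c) (Y', g, Z) (X, f, Y) = (X, g \<cdot>\<^bsub>D\<^esub> f, Z)"
  by (simp_all add: over_cat_def)

lemma over_cat_hom_iff:
  "u \<in> hom (over_cat D C i c) X Y \<longleftrightarrow>
    (\<exists>f. u = (X, f, Y) \<and> X \<in> Ob (over_cat D C i c) \<and> Y \<in> Ob (over_cat D C i c) \<and>
      f \<in> hom D (fst X) (fst Y) \<and> snd X = snd Y \<cdot>\<^bsub>C\<^esub> FAr i f)"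
  unfolding hom_def[of "over_cat D C i c"] by (cases X; cases Y) (auto simp: over_cat_def)

lemma dense_cocone:
  assumes "dense_for D C M i F" "cat_functor C M F" "cat_functor D C i" "c \<in> Ob C"
  shows "cocone (over_cat D C i c) M (F \<circ>\<^sub>F i \<circ>\<^sub>F over_proj) n \<nu> \<longleftrightarrow> n \<in> Ob M \<and>
    (\<forall>d\<in>Ob D. \<forall>\<sigma>\<in>hom C (FOb i d) c. \<nu> (d, \<sigma>) \<in> hom M (FOb F (FOb i d)) n) \<and>
    (\<forall>d\<in>Ob D. \<forall>d'\<in>Ob D. \<forall>\<sigma>\<in>hom C (FOb i d') c. \<forall>u\<in>hom D d d'.
      \<nu> (d', \<sigma>) \<cdot>\<^bsub>M\<^esub> FAr F (FAr i u) = \<nu> (d, \<sigma> \<cdot>\<^bsub>C\<^esub> FAr i u))"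
proof -
  interpret i: cat_functor D C i by fact
  have "\<sigma> \<cdot>\<^bsub>C\<^esub> FAr i u \<in> hom C (FOb i d) c"
    if "u \<in> hom D d d'" "\<sigma> \<in> hom C (FOb i d') c" for u d d' \<sigma>
    using i.target.Comp_hom i.FAr_hom that by blast
  then show ?thesis
    unfolding cocone_def by (fastforce simp: over_cat_def over_proj_def comp_fctr_def)
qed

lemma dense_induced:
  assumes dense: "dense_for D C M i F" "cat_functor C M F" "cat_functor D C i" "c \<in> Ob C"
    and n: "n \<in> Ob M"
    and \<nu>: "\<And>d \<sigma>. \<lbrakk>d \<in> Ob D; \<sigma> \<in> hom C (FOb i d) c\<rbrakk> \<Longrightarrow> \<nu> d \<sigma> \<in> hom M (FOb F (FOb i d)) n"
    and natural: "\<And>d d' \<sigma> u. \<lbrakk>d \<in> Ob D; d' \<in> Ob D; \<sigma> \<in> hom C (FOb i d') c; u \<in> hom D d d'\<rbrakk>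
      \<Longrightarrow> \<nu> d' \<sigma> \<cdot>\<^bsub>M\<^esub> FAr F (FAr i u) = \<nu> d (\<sigma> \<cdot>\<^bsub>C\<^esub> FAr i u)"
  shows "\<exists>!u. u \<in> hom M (FOb F c) n \<and>
    (\<forall>d\<in>Ob D. \<forall>\<sigma>\<in>hom C (FOb i d) c. u \<cdot>\<^bsub>M\<^esub> FAr F \<sigma> = \<nu> d \<sigma>)"
proof -
  have "cocone (over_cat D C i c) M (F \<circ>\<^sub>F i \<circ>\<^sub>F over_proj) n (\<lambda>(d, \<sigma>). \<nu> d \<sigma>)"
    unfolding dense_cocone[OF dense] using n \<nu> natural by simp
  then have "\<exists>!u. u \<in> hom M (FOb F c) n \<and> (\<forall>j\<in>Ob (over_cat D C i c).
      u \<cdot>\<^bsub>M\<^esub> (case j of (d, \<sigma>) \<Rightarrow> FAr F \<sigma>) = (case j of (d, \<sigma>) \<Rightarrow> \<nu> d \<sigma>))"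
    using dense(1,4) unfolding dense_for_def is_colimit_def by blast
  moreover have "(\<forall>j\<in>Ob (over_cat D C i c).
      u \<cdot>\<^bsub>M\<^esub> (case j of (d, \<sigma>) \<Rightarrow> FAr F \<sigma>) = (case j of (d, \<sigma>) \<Rightarrow> \<nu> d \<sigma>))
    \<longleftrightarrow> (\<forall>d\<in>Ob D. \<forall>\<sigma>\<in>hom C (FOb i d) c. u \<cdot>\<^bsub>M\<^esub> FAr F \<sigma> = \<nu> d \<sigma>)" for u
    by (auto simp: over_cat_sel)
  ultimately show ?thesis by simp
qed

text \<open>The composites of \<open>a\<close> with the \<open>F \<sigma>\<close> form a cocone, through which an arrow factors
uniquely.\<close>

lemma dense_arrow_eqI:
  assumes dense: "dense_for D C M i F" "cat_functor C M F" "cat_functor D C i" "c \<in> Ob C"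
    and a: "a \<in> hom M (FOb F c) n" and b: "b \<in> hom M (FOb F c) n"
    and eq: "\<And>d \<sigma>. \<lbrakk>d \<in> Ob D; \<sigma> \<in> hom C (FOb i d) c\<rbrakk> \<Longrightarrow> a \<cdot>\<^bsub>M\<^esub> FAr F \<sigma> = b \<cdot>\<^bsub>M\<^esub> FAr F \<sigma>"
  shows "a = b"
proof -
  interpret F: cat_functor C M F by fact
  interpret i: cat_functor D C i by fact
  note s = F.source.arrow_simps F.target.arrow_simps F.fctr_simps i.fctr_simps
  have "\<exists>!u. u \<in> hom M (FOb F c) n \<and>
      (\<forall>d\<in>Ob D. \<forall>\<sigma>\<in>hom C (FOb i d) c. u \<cdot>\<^bsub>M\<^esub> FAr F \<sigma> = a \<cdot>\<^bsub>M\<^esub> FAr F \<sigma>)"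
  proof (rule dense_induced[OF dense])
    show "n \<in> Ob M" using a F.target.Cod_Ob by (auto simp: hom_def)
  qed (use a in \<open>auto simp: hom_def s\<close>)
  then show ?thesis using a b eq by metis
qed

section \<open>Factorizations through the wide subcategory\<close>

text \<open>The retraction \<open>r\<^sub>c\<close> sends \<open>(d, \<sigma>)\<close> to \<open>(mid d \<sigma>, rgt d \<sigma>)\<close>, and \<open>lft d \<sigma>\<close> is the
image under \<open>i\<close> of the component \<open>s\<^sub>\<sigma>\<close>. The object \<open>c\<close> is the codomain of \<open>\<sigma>\<close> and
need not be a parameter; \<open>d\<close> is one because \<open>i\<close> may identify objects. In
\<open>factor_natural\<close> the arrow \<open>v\<close> is the retraction of \<open>u\<close>. The three push rules express
that \<open>r\<^sub>y (f\<^sub>* s\<^sub>\<sigma>)\<close> is an identity.\<close>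

locale over_factorization =
  i: cat_functor D C i
  for D :: "('do, 'da) cat" and C :: "('co, 'ca) cat" and i :: "('do, 'da, 'co, 'ca) fctr" +
  fixes I :: "'ca set" and mid :: "'do \<Rightarrow> 'ca \<Rightarrow> 'do"
    and lft :: "'do \<Rightarrow> 'ca \<Rightarrow> 'ca" and rgt :: "'do \<Rightarrow> 'ca \<Rightarrow> 'ca"
  assumes wide: "wide_subcategory C I"
    and mid_Ob: "\<lbrakk>d \<in> Ob D; \<sigma> \<in> hom C (FOb i d) c\<rbrakk> \<Longrightarrow> mid d \<sigma> \<in> Ob D"
    and rgt_hom: "\<lbrakk>d \<in> Ob D; \<sigma> \<in> hom C (FOb i d) c\<rbrakk> \<Longrightarrow> rgt d \<sigma> \<in> hom C (FOb i (mid d \<sigma>)) c"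
    and rgt_I: "\<lbrakk>d \<in> Ob D; \<sigma> \<in> hom C (FOb i d) c\<rbrakk> \<Longrightarrow> rgt d \<sigma> \<in> I"
    and lft_hom: "\<lbrakk>d \<in> Ob D; \<sigma> \<in> hom C (FOb i d) c\<rbrakk>
      \<Longrightarrow> lft d \<sigma> \<in> hom C (FOb i d) (FOb i (mid d \<sigma>))"
    and factor: "\<lbrakk>d \<in> Ob D; \<sigma> \<in> hom C (FOb i d) c\<rbrakk> \<Longrightarrow> rgt d \<sigma> \<cdot>\<^bsub>C\<^esub> lft d \<sigma> = \<sigma>"
    and mid_of_I: "\<lbrakk>d \<in> Ob D; \<sigma> \<in> hom C (FOb i d) c; \<sigma> \<in> I\<rbrakk> \<Longrightarrow> mid d \<sigma> = d"
    and rgt_of_I: "\<lbrakk>d \<in> Ob D; \<sigma> \<in> hom C (FOb i d) c; \<sigma> \<in> I\<rbrakk> \<Longrightarrow> rgt d \<sigma> = \<sigma>"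
    and lft_of_I: "\<lbrakk>d \<in> Ob D; \<sigma> \<in> hom C (FOb i d) c; \<sigma> \<in> I\<rbrakk> \<Longrightarrow> lft d \<sigma> = Ide C (FOb i d)"
    and factor_natural: "\<lbrakk>d \<in> Ob D; d' \<in> Ob D; \<sigma> \<in> hom C (FOb i d') c; u \<in> hom D d d'\<rbrakk>
      \<Longrightarrow> \<exists>v\<in>hom D (mid d (\<sigma> \<cdot>\<^bsub>C\<^esub> FAr i u)) (mid d' \<sigma>). FAr i v \<in> I \<and>
        rgt d (\<sigma> \<cdot>\<^bsub>C\<^esub> FAr i u) = rgt d' \<sigma> \<cdot>\<^bsub>C\<^esub> FAr i v \<and>
        lft d' \<sigma> \<cdot>\<^bsub>C\<^esub> FAr i u = FAr i v \<cdot>\<^bsub>C\<^esub> lft d (\<sigma> \<cdot>\<^bsub>C\<^esub> FAr i u)"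
    and mid_push: "\<lbrakk>d \<in> Ob D; \<sigma> \<in> hom C (FOb i d) x; f \<in> hom C x y\<rbrakk>
      \<Longrightarrow> mid (mid d \<sigma>) (f \<cdot>\<^bsub>C\<^esub> rgt d \<sigma>) = mid d (f \<cdot>\<^bsub>C\<^esub> \<sigma>)"
    and rgt_push: "\<lbrakk>d \<in> Ob D; \<sigma> \<in> hom C (FOb i d) x; f \<in> hom C x y\<rbrakk>
      \<Longrightarrow> rgt (mid d \<sigma>) (f \<cdot>\<^bsub>C\<^esub> rgt d \<sigma>) = rgt d (f \<cdot>\<^bsub>C\<^esub> \<sigma>)"
    and lft_push: "\<lbrakk>d \<in> Ob D; \<sigma> \<in> hom C (FOb i d) x; f \<in> hom C x y\<rbrakk>
      \<Longrightarrow> lft (mid d \<sigma>) (f \<cdot>\<^bsub>C\<^esub> rgt d \<sigma>) \<cdot>\<^bsub>C\<^esub> lft d \<sigma> = lft d (f \<cdot>\<^bsub>C\<^esub> \<sigma>)"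

text \<open>In \<open>push\<close> below, \<open>f\<^sub>* s\<^sub>\<sigma>\<close> is an arrow from \<open>(d, f \<cdot> \<sigma>)\<close> to \<open>(mid d \<sigma>, f \<cdot> rgt d \<sigma>)\<close>.
If its retraction is an identity, then its ends have the same image under \<open>r\<^sub>y\<close>, and
naturality of \<open>s\<close> at this arrow says that the left part of \<open>f \<cdot> \<sigma>\<close> is the composite of the
two other left parts.\<close>

lemma I_dense_for_factorization:
  assumes i: "cat_functor D C i" and I: "wide_subcategory C I"
    and dense: "I_dense_for D C M I i F"
  shows "\<exists>mid lft rgt. over_factorization D C i I mid lft rgt"
proof -
  interpret i: cat_functor D C i by fact
  obtain r s where
      r: "\<And>c. c \<in> Ob C \<Longrightarrow> is_retraction D C I i c (r c)"
    and nt: "\<And>c. c \<in> Ob C \<Longrightarrow>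
      nat_trans (over_cat D C i c) (over_cat D C i c) id_fctr (id_fctr \<circ>\<^sub>F r c) (s c)"
    and s_I: "\<And>c X. \<lbrakk>c \<in> Ob C; X \<in> Ob (over_subcat D C I i c)\<rbrakk>
      \<Longrightarrow> s c X = Ide (over_cat D C i c) X"
    and push_id: "\<And>x y f X. \<lbrakk>x \<in> Ob C; y \<in> Ob C; f \<in> hom C x y; X \<in> Ob (over_cat D C i x)\<rbrakk>
      \<Longrightarrow> is_identity (over_cat D C i y) (FAr (r y) (FAr (over_push C f) (s x X)))"
    using dense unfolding I_dense_for_def by blast
  have c_Ob: "c \<in> Ob C" if "\<sigma> \<in> hom C x c" for \<sigma> x c
    using that i.target.Cod_Ob by (auto simp: hom_def)
  have rfun: "cat_functor (over_cat D C i c) (over_subcat D C I i c) (r c)" if "c \<in> Ob C" for c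
    using r[OF that] by (simp add: is_retraction_def)
  have subhom: "u \<in> hom (over_subcat D C I i c) X Y \<longleftrightarrow> u \<in> hom (over_cat D C i c) X Y \<and>
      snd X \<in> I \<and> snd Y \<in> I \<and> FAr i (fst (snd u)) \<in> I" for u X Y c
    unfolding hom_def by (auto simp: over_subcat_def over_cat_def)
  have subOb: "X \<in> Ob (over_subcat D C I i c) \<longleftrightarrow> X \<in> Ob (over_cat D C i c) \<and> snd X \<in> I" for X c
    by (auto simp: over_subcat_def)
  define mid where "mid d \<sigma> = fst (FOb (r (Cod C \<sigma>)) (d, \<sigma>))" for d \<sigma>
  define rgt where "rgt d \<sigma> = snd (FOb (r (Cod C \<sigma>)) (d, \<sigma>))" for d \<sigma>
  \<comment> \<open>The arrow of \<open>D\<close> above \<open>lft\<close>: naturality of \<open>s\<close> is an equation between arrows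
    of \<open>D\<close>, to which \<open>i\<close> is applied only at the end.\<close>
  define ld where "ld d \<sigma> = fst (snd (s (Cod C \<sigma>) (d, \<sigma>)))" for d \<sigma>
  define lft where "lft d \<sigma> = FAr i (ld d \<sigma>)" for d \<sigma>
  have r_eq: "FOb (r c) (d, \<sigma>) = (mid d \<sigma>, rgt d \<sigma>)" if "\<sigma> \<in> hom C (FOb i d) c" for d \<sigma> c
    using that by (simp add: mid_def rgt_def hom_def)
  have rOb: "mid d \<sigma> \<in> Ob D \<and> rgt d \<sigma> \<in> hom C (FOb i (mid d \<sigma>)) c \<and> rgt d \<sigma> \<in> I"
    if "d \<in> Ob D" "\<sigma> \<in> hom C (FOb i d) c" for d \<sigma> c
  proof -
    interpret r: cat_functor "over_cat D C i c" "over_subcat D C I i c" "r c"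
      using rfun c_Ob that by blast
    have "FOb (r c) (d, \<sigma>) \<in> Ob (over_subcat D C I i c)"
      using that by (intro r.FOb_Ob) (simp add: over_cat_sel)
    then show ?thesis using that by (simp add: r_eq subOb over_cat_sel)
  qed
  have s_eq: "s c (d, \<sigma>) = ((d, \<sigma>), ld d \<sigma>, (mid d \<sigma>, rgt d \<sigma>)) \<and>
      ld d \<sigma> \<in> hom D d (mid d \<sigma>) \<and> \<sigma> = rgt d \<sigma> \<cdot>\<^bsub>C\<^esub> lft d \<sigma>"
    if "d \<in> Ob D" "\<sigma> \<in> hom C (FOb i d) c" for d \<sigma> c
  proof -
    have "s c (d, \<sigma>) \<in> hom (over_cat D C i c) (d, \<sigma>) (mid d \<sigma>, rgt d \<sigma>)"
      using nt[OF c_Ob[OF that(2)]] that unfolding nat_trans_def r_eq[OF that(2), symmetric]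
      by (simp add: over_cat_sel id_fctr_def comp_fctr_def)
    moreover have "Cod C \<sigma> = c" using that by (simp add: hom_def)
    ultimately show ?thesis by (auto simp: over_cat_hom_iff ld_def lft_def)
  qed
  have nat: "\<exists>v. v \<in> hom D (mid d1 \<sigma>1) (mid d2 \<sigma>2) \<and> FAr i v \<in> I \<and>
      FAr (r c) ((d1, \<sigma>1), u, (d2, \<sigma>2)) = ((mid d1 \<sigma>1, rgt d1 \<sigma>1), v, (mid d2 \<sigma>2, rgt d2 \<sigma>2)) \<and>
      rgt d1 \<sigma>1 = rgt d2 \<sigma>2 \<cdot>\<^bsub>C\<^esub> FAr i v \<and> ld d2 \<sigma>2 \<cdot>\<^bsub>D\<^esub> u = v \<cdot>\<^bsub>D\<^esub> ld d1 \<sigma>1"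
    if d: "d1 \<in> Ob D" "d2 \<in> Ob D" "\<sigma>2 \<in> hom C (FOb i d2) c" "u \<in> hom D d1 d2"
      "\<sigma>1 = \<sigma>2 \<cdot>\<^bsub>C\<^esub> FAr i u"
    for d1 \<sigma>1 d2 \<sigma>2 u c
  proof -
    have \<sigma>1: "\<sigma>1 \<in> hom C (FOb i d1) c"
      using d i.target.Comp_hom i.FAr_hom by blast
    interpret r: cat_functor "over_cat D C i c" "over_subcat D C I i c" "r c"
      using rfun c_Ob \<sigma>1 by blast
    let ?u = "((d1, \<sigma>1), u, (d2, \<sigma>2))"
    have u: "?u \<in> hom (over_cat D C i c) (d1, \<sigma>1) (d2, \<sigma>2)"
      using d \<sigma>1 by (simp add: over_cat_hom_iff over_cat_sel)
    have "FAr (r c) ?u \<in> hom (over_cat D C i c) (mid d1 \<sigma>1, rgt d1 \<sigma>1) (mid d2 \<sigma>2, rgt d2 \<sigma>2) \<and>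
        FAr i (fst (snd (FAr (r c) ?u))) \<in> I"
      using r.FAr_hom[OF u] unfolding subhom r_eq[OF \<sigma>1] r_eq[OF d(3)] by simp
    then obtain v where v: "FAr (r c) ?u = ((mid d1 \<sigma>1, rgt d1 \<sigma>1), v, (mid d2 \<sigma>2, rgt d2 \<sigma>2))"
      "v \<in> hom D (mid d1 \<sigma>1) (mid d2 \<sigma>2)" "rgt d1 \<sigma>1 = rgt d2 \<sigma>2 \<cdot>\<^bsub>C\<^esub> FAr i v" "FAr i v \<in> I"
      by (auto simp: over_cat_hom_iff)
    have "s c (d2, \<sigma>2) \<cdot>\<^bsub>over_cat D C i c\<^esub> ?u = FAr (r c) ?u \<cdot>\<^bsub>over_cat D C i c\<^esub> s c (d1, \<sigma>1)"
      using nt[OF c_Ob[OF \<sigma>1]] u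
      by (auto simp: nat_trans_def id_fctr_def comp_fctr_def over_cat_sel
          hom_def[of "over_cat D C i c"])
    then have "ld d2 \<sigma>2 \<cdot>\<^bsub>D\<^esub> u = v \<cdot>\<^bsub>D\<^esub> ld d1 \<sigma>1"
      using s_eq[OF d(1) \<sigma>1] s_eq[OF d(2,3)] v(1) by (simp add: over_cat_sel)
    then show ?thesis using v by blast
  qed
  have push: "mid (mid d \<sigma>) (f \<cdot>\<^bsub>C\<^esub> rgt d \<sigma>) = mid d (f \<cdot>\<^bsub>C\<^esub> \<sigma>) \<and>
      rgt (mid d \<sigma>) (f \<cdot>\<^bsub>C\<^esub> rgt d \<sigma>) = rgt d (f \<cdot>\<^bsub>C\<^esub> \<sigma>) \<and>
      lft (mid d \<sigma>) (f \<cdot>\<^bsub>C\<^esub> rgt d \<sigma>) \<cdot>\<^bsub>C\<^esub> lft d \<sigma> = lft d (f \<cdot>\<^bsub>C\<^esub> \<sigma>)"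
    if d: "d \<in> Ob D" "\<sigma> \<in> hom C (FOb i d) x" and f: "f \<in> hom C x y" for d \<sigma> x f y
  proof -
    note m = rOb[OF d] and s = s_eq[OF d]
    have l: "lft d \<sigma> \<in> hom C (FOb i d) (FOb i (mid d \<sigma>))"
      using s i.FAr_hom by (simp add: lft_def)
    have f\<sigma>: "f \<cdot>\<^bsub>C\<^esub> \<sigma> = f \<cdot>\<^bsub>C\<^esub> rgt d \<sigma> \<cdot>\<^bsub>C\<^esub> FAr i (ld d \<sigma>)"
      using i.target.Comp_assoc[OF l conjunct1[OF conjunct2[OF m]] f] s unfolding lft_def by metis
    have fr: "f \<cdot>\<^bsub>C\<^esub> rgt d \<sigma> \<in> hom C (FOb i (mid d \<sigma>)) y"
      and fs: "f \<cdot>\<^bsub>C\<^esub> \<sigma> \<in> hom C (FOb i d) y"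
      using m d i.target.Comp_hom[OF _ f] by blast+
    obtain v where v: "FAr (r y) ((d, f \<cdot>\<^bsub>C\<^esub> \<sigma>), ld d \<sigma>, (mid d \<sigma>, f \<cdot>\<^bsub>C\<^esub> rgt d \<sigma>)) =
        ((mid d (f \<cdot>\<^bsub>C\<^esub> \<sigma>), rgt d (f \<cdot>\<^bsub>C\<^esub> \<sigma>)), v,
          (mid (mid d \<sigma>) (f \<cdot>\<^bsub>C\<^esub> rgt d \<sigma>), rgt (mid d \<sigma>) (f \<cdot>\<^bsub>C\<^esub> rgt d \<sigma>)))"
      and nat': "ld (mid d \<sigma>) (f \<cdot>\<^bsub>C\<^esub> rgt d \<sigma>) \<cdot>\<^bsub>D\<^esub> ld d \<sigma> = v \<cdot>\<^bsub>D\<^esub> ld d (f \<cdot>\<^bsub>C\<^esub> \<sigma>)"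
      using nat[OF d(1) conjunct1[OF m] fr conjunct1[OF conjunct2[OF s]] f\<sigma>] by blast
    have "is_identity (over_cat D C i y) (FAr (r y) (FAr (over_push C f) (s x (d, \<sigma>))))"
      using push_id c_Ob[OF d(2)] c_Ob[OF f] f d by (simp add: over_cat_sel)
    moreover have "FAr (over_push C f) (s x (d, \<sigma>)) =
        ((d, f \<cdot>\<^bsub>C\<^esub> \<sigma>), ld d \<sigma>, (mid d \<sigma>, f \<cdot>\<^bsub>C\<^esub> rgt d \<sigma>))"
      using s by (simp add: over_push_def)
    ultimately have e: "mid (mid d \<sigma>) (f \<cdot>\<^bsub>C\<^esub> rgt d \<sigma>) = mid d (f \<cdot>\<^bsub>C\<^esub> \<sigma>)"
        "rgt (mid d \<sigma>) (f \<cdot>\<^bsub>C\<^esub> rgt d \<sigma>) = rgt d (f \<cdot>\<^bsub>C\<^esub> \<sigma>)"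
        "v = Ide D (mid d (f \<cdot>\<^bsub>C\<^esub> \<sigma>))"
      using v by (auto simp: is_identity_def over_cat_sel)
    have "ld (mid d \<sigma>) (f \<cdot>\<^bsub>C\<^esub> rgt d \<sigma>) \<cdot>\<^bsub>D\<^esub> ld d \<sigma> = ld d (f \<cdot>\<^bsub>C\<^esub> \<sigma>)"
      using nat' e(3) i.source.Ide_Comp[OF conjunct1[OF conjunct2[OF s_eq[OF d(1) fs]]]] by simp
    then have "lft (mid d \<sigma>) (f \<cdot>\<^bsub>C\<^esub> rgt d \<sigma>) \<cdot>\<^bsub>C\<^esub> lft d \<sigma> = lft d (f \<cdot>\<^bsub>C\<^esub> \<sigma>)"
      unfolding lft_def using i.FAr_Comp s s_eq[OF conjunct1[OF m] fr] by metis
    then show ?thesis using e by blast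
  qed
  have of_I: "mid d \<sigma> = d \<and> rgt d \<sigma> = \<sigma> \<and> lft d \<sigma> = Ide C (FOb i d)"
    if d: "d \<in> Ob D" "\<sigma> \<in> hom C (FOb i d) c" "\<sigma> \<in> I" for d \<sigma> c
  proof -
    have X: "(d, \<sigma>) \<in> Ob (over_subcat D C I i c)" using d by (simp add: subOb over_cat_sel)
    have "FOb (r c) (d, \<sigma>) = (d, \<sigma>)"
      using r[OF c_Ob[OF d(2)]] X by (simp add: is_retraction_def)
    moreover have "ld d \<sigma> = Ide D d"
      using s_I[OF c_Ob[OF d(2)] X] s_eq[OF d(1,2)] by (simp add: over_cat_sel)
    ultimately show ?thesis using r_eq[OF d(2)] d by (simp add: lft_def i.FAr_Ide)
  qed
  have lft: "lft d \<sigma> \<in> hom C (FOb i d) (FOb i (mid d \<sigma>))"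
    if d: "d \<in> Ob D" "\<sigma> \<in> hom C (FOb i d) c" for d \<sigma> c
    using s_eq[OF d] i.FAr_hom by (simp add: lft_def)
  have natC: "\<exists>v\<in>hom D (mid d (\<sigma> \<cdot>\<^bsub>C\<^esub> FAr i u)) (mid d' \<sigma>). FAr i v \<in> I \<and>
        rgt d (\<sigma> \<cdot>\<^bsub>C\<^esub> FAr i u) = rgt d' \<sigma> \<cdot>\<^bsub>C\<^esub> FAr i v \<and>
        lft d' \<sigma> \<cdot>\<^bsub>C\<^esub> FAr i u = FAr i v \<cdot>\<^bsub>C\<^esub> lft d (\<sigma> \<cdot>\<^bsub>C\<^esub> FAr i u)"
    if d: "d \<in> Ob D" "d' \<in> Ob D" "\<sigma> \<in> hom C (FOb i d') c" "u \<in> hom D d d'" for d d' \<sigma> c u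
  proof -
    have "\<sigma> \<cdot>\<^bsub>C\<^esub> FAr i u \<in> hom C (FOb i d) c"
      using d i.target.Comp_hom i.FAr_hom by blast
    note l = s_eq[OF d(1) this] s_eq[OF d(2,3)]
    obtain v where v: "v \<in> hom D (mid d (\<sigma> \<cdot>\<^bsub>C\<^esub> FAr i u)) (mid d' \<sigma>)" "FAr i v \<in> I"
      "rgt d (\<sigma> \<cdot>\<^bsub>C\<^esub> FAr i u) = rgt d' \<sigma> \<cdot>\<^bsub>C\<^esub> FAr i v"
      "ld d' \<sigma> \<cdot>\<^bsub>D\<^esub> u = v \<cdot>\<^bsub>D\<^esub> ld d (\<sigma> \<cdot>\<^bsub>C\<^esub> FAr i u)"
      using nat[OF d refl] by blast
    have "lft d' \<sigma> \<cdot>\<^bsub>C\<^esub> FAr i u = FAr i v \<cdot>\<^bsub>C\<^esub> lft d (\<sigma> \<cdot>\<^bsub>C\<^esub> FAr i u)"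
      unfolding lft_def using i.FAr_Comp v d(4) l by metis
    then show ?thesis using v by blast
  qed
  have "over_factorization D C i I mid lft rgt"
    by unfold_locales (use I rOb s_eq lft of_I natC push in \<open>blast | metis\<close>)+
  then show ?thesis by blast
qed

section \<open>Extending along a dense functor\<close>

locale twisted_extension =
  over_factorization D C i I mid lft rgt + F: cat_functor C M F + G: cat_functor C M G
  for D :: "('do, 'da) cat" and C :: "('co, 'ca) cat" and i :: "('do, 'da, 'co, 'ca) fctr"
    and I mid lft rgt and M :: "('mo, 'ma) cat" and F G :: "('co, 'ca, 'mo, 'ma) fctr" +
  fixes \<alpha> t :: "'ca \<Rightarrow> 'ma"
  assumes full: "full_functor D C i"
    and dense_F: "dense_for D C M i F" and dense_G: "dense_for D C M i G"
    and twisted: "twisted_nat_trans (image_cat D C i) M (I \<inter> Ar (image_cat D C i)) F G \<alpha> t"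
begin

lemmas arr = i.target.arrow_simps F.target.arrow_simps F.fctr_simps G.fctr_simps i.fctr_simps

lemma image_Ar: "\<lbrakk>d \<in> Ob D; d' \<in> Ob D; f \<in> hom C (FOb i d) (FOb i d')\<rbrakk> \<Longrightarrow> f \<in> Ar (image_cat D C i)"
  by (auto simp: Ar_image_cat[OF full] hom_def)

lemma \<alpha>_hom:
  assumes "d \<in> Ob D" "d' \<in> Ob D" "f \<in> hom C (FOb i d) (FOb i d')"
  shows "\<alpha> f \<in> hom M (FOb F (FOb i d)) (FOb G (FOb i d'))"
  using twisted image_Ar[OF assms] assms(3) by (auto simp: twisted_nat_trans_def hom_def)

lemma t_hom:
  assumes "d \<in> Ob D" "d' \<in> Ob D" "f \<in> hom C (FOb i d) (FOb i d')"
  shows "t f \<in> hom M (FOb G (FOb i d)) (FOb G (FOb i d))"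
  using twisted image_Ar[OF assms] assms(3) by (auto simp: twisted_nat_trans_def hom_def)

lemma t_of_I:
  assumes "d \<in> Ob D" "d' \<in> Ob D" "f \<in> hom C (FOb i d) (FOb i d')" "f \<in> I"
  shows "t f = Ide M (FOb G (FOb i d))"
  using twisted image_Ar[OF assms(1-3)] assms(3,4) by (auto simp: twisted_nat_trans_def hom_def)

lemma t_square:
  assumes d: "a \<in> Ob D" "a' \<in> Ob D" "b \<in> Ob D" "b' \<in> Ob D"
    and f1: "f1 \<in> hom C (FOb i a) (FOb i a')" "f1 \<in> I"
    and f2: "f2 \<in> hom C (FOb i b) (FOb i b')" "f2 \<in> I"
    and g1: "g1 \<in> hom C (FOb i a) (FOb i b)"
    and g2: "g2 \<in> hom C (FOb i a') (FOb i b')"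
    and eq: "f2 \<cdot>\<^bsub>C\<^esub> g1 = g2 \<cdot>\<^bsub>C\<^esub> f1"
  shows "FAr G f1 \<cdot>\<^bsub>M\<^esub> t g1 = t g2 \<cdot>\<^bsub>M\<^esub> FAr G f1"
proof -
  have "f1 \<in> I \<inter> Ar (image_cat D C i)" "f2 \<in> I \<inter> Ar (image_cat D C i)"
    "g1 \<in> Ar (image_cat D C i)" "g2 \<in> Ar (image_cat D C i)"
    using image_Ar d f1 f2 g1 g2 by blast+
  moreover have "Cod C g1 = Dom C f2" "Cod C f1 = Dom C g2" "Dom C g1 = Dom C f1"
    using f1 f2 g1 g2 by (simp_all add: hom_def)
  ultimately show ?thesis
    using twisted eq unfolding twisted_nat_trans_def image_cat_simps by blast
qed

lemma \<alpha>_pre: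
  assumes d: "a \<in> Ob D" "b \<in> Ob D" "c \<in> Ob D"
    and "f \<in> hom C (FOb i a) (FOb i b)" "g \<in> hom C (FOb i b) (FOb i c)"
  shows "\<alpha> (g \<cdot>\<^bsub>C\<^esub> f) = \<alpha> g \<cdot>\<^bsub>M\<^esub> FAr F f"
  using twisted_precompose[OF category_image_cat[OF full] wide_subcategory_image_cat[OF full wide]
      cat_functor_image_cat[OF full F.cat_functor_axioms]
      cat_functor_image_cat[OF full G.cat_functor_axioms] twisted]
    image_Ar assms by (simp add: hom_def)

lemma \<alpha>_post:
  assumes d: "a \<in> Ob D" "b \<in> Ob D" "c \<in> Ob D"
    and "f \<in> hom C (FOb i a) (FOb i b)" "g \<in> hom C (FOb i b) (FOb i c)"
  shows "\<alpha> (g \<cdot>\<^bsub>C\<^esub> f) = FAr G g \<cdot>\<^bsub>M\<^esub> t g \<cdot>\<^bsub>M\<^esub> \<alpha> f"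
  using twisted_postcompose[OF category_image_cat[OF full] wide_subcategory_image_cat[OF full wide]
      cat_functor_image_cat[OF full F.cat_functor_axioms]
      cat_functor_image_cat[OF full G.cat_functor_axioms] twisted]
    image_Ar assms by (simp add: hom_def)

text \<open>The equations determine the arrows because the \<open>F \<sigma>\<close>, respectively the \<open>G \<sigma>\<close>, form a
colimit cocone; see \<open>component_test\<close> and \<open>twist_test\<close>.\<close>

definition component :: "'co \<Rightarrow> 'ma" where
  "component c = (THE u. u \<in> hom M (FOb F c) (FOb G c) \<and>
    (\<forall>d\<in>Ob D. \<forall>\<sigma>\<in>hom C (FOb i d) c.
      u \<cdot>\<^bsub>M\<^esub> FAr F \<sigma> = FAr G (rgt d \<sigma>) \<cdot>\<^bsub>M\<^esub> \<alpha> (lft d \<sigma>)))"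

definition twist :: "'ca \<Rightarrow> 'ma" where
  "twist f = (THE u. u \<in> hom M (FOb G (Dom C f)) (FOb G (Dom C f)) \<and>
    (\<forall>d\<in>Ob D. \<forall>\<sigma>\<in>hom C (FOb i d) (Dom C f).
      u \<cdot>\<^bsub>M\<^esub> FAr G \<sigma> = FAr G (rgt d \<sigma>) \<cdot>\<^bsub>M\<^esub>
        (t (lft (mid d \<sigma>) (f \<cdot>\<^bsub>C\<^esub> rgt d \<sigma>)) \<cdot>\<^bsub>M\<^esub> FAr G (lft d \<sigma>))))"

text \<open>With \<open>v\<close> the comparison arrow of \<open>u\<close>, the arrow \<open>\<alpha> (i v \<cdot> lft)\<close> equals
\<open>G (i v) \<cdot> \<alpha> lft\<close>, since \<open>i v\<close> is in \<open>I\<close> and so has trivial twist; and \<open>G (i v)\<close> is what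
distinguishes the two right parts.\<close>

lemma component_cocone:
  assumes d: "d \<in> Ob D" "d' \<in> Ob D" and \<sigma>: "\<sigma> \<in> hom C (FOb i d') c" and u: "u \<in> hom D d d'"
  shows "FAr G (rgt d' \<sigma>) \<cdot>\<^bsub>M\<^esub> \<alpha> (lft d' \<sigma>) \<cdot>\<^bsub>M\<^esub> FAr F (FAr i u)
    = FAr G (rgt d (\<sigma> \<cdot>\<^bsub>C\<^esub> FAr i u)) \<cdot>\<^bsub>M\<^esub> \<alpha> (lft d (\<sigma> \<cdot>\<^bsub>C\<^esub> FAr i u))"
proof -
  let ?\<sigma> = "\<sigma> \<cdot>\<^bsub>C\<^esub> FAr i u"
  have iu: "FAr i u \<in> hom C (FOb i d) (FOb i d')" using u by (rule i.FAr_hom)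
  then have \<sigma>u: "?\<sigma> \<in> hom C (FOb i d) c" using \<sigma> i.target.Comp_hom by blast
  obtain v where v: "v \<in> hom D (mid d ?\<sigma>) (mid d' \<sigma>)" "FAr i v \<in> I"
      and vr: "rgt d ?\<sigma> = rgt d' \<sigma> \<cdot>\<^bsub>C\<^esub> FAr i v"
      and vl: "lft d' \<sigma> \<cdot>\<^bsub>C\<^esub> FAr i u = FAr i v \<cdot>\<^bsub>C\<^esub> lft d ?\<sigma>"
    using factor_natural[OF d \<sigma> u] by blast
  have iv: "FAr i v \<in> hom C (FOb i (mid d ?\<sigma>)) (FOb i (mid d' \<sigma>))" using v by (intro i.FAr_hom)
  note m = mid_Ob[OF d(1) \<sigma>u] mid_Ob[OF d(2) \<sigma>]
  note l = lft_hom[OF d(1) \<sigma>u] lft_hom[OF d(2) \<sigma>]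
  note r = rgt_hom[OF d(1) \<sigma>u] rgt_hom[OF d(2) \<sigma>]
  note a = \<alpha>_hom[OF d(1) m(1) l(1)] \<alpha>_hom[OF d(2) m(2) l(2)]
  have "FAr G (rgt d' \<sigma>) \<cdot>\<^bsub>M\<^esub> \<alpha> (lft d' \<sigma>) \<cdot>\<^bsub>M\<^esub> FAr F (FAr i u)
      = FAr G (rgt d' \<sigma>) \<cdot>\<^bsub>M\<^esub> \<alpha> (lft d' \<sigma> \<cdot>\<^bsub>C\<^esub> FAr i u)"
    unfolding \<alpha>_pre[OF d m(2) iu l(2)] using r iu a by (simp add: hom_def arr)
  also have "\<dots> = FAr G (rgt d' \<sigma>) \<cdot>\<^bsub>M\<^esub> (FAr G (FAr i v) \<cdot>\<^bsub>M\<^esub> \<alpha> (lft d ?\<sigma>))"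
    unfolding vl \<alpha>_post[OF d(1) m l(1) iv] t_of_I[OF m iv v(2)]
    using iv by (simp add: hom_def arr)
  also have "\<dots> = FAr G (rgt d ?\<sigma>) \<cdot>\<^bsub>M\<^esub> \<alpha> (lft d ?\<sigma>)"
    unfolding vr using iv r a by (simp add: hom_def arr)
  finally show ?thesis .
qed

lemma component:
  assumes c: "c \<in> Ob C"
  shows component_hom: "component c \<in> hom M (FOb F c) (FOb G c)"
    and component_test: "\<lbrakk>d \<in> Ob D; \<sigma> \<in> hom C (FOb i d) c\<rbrakk>
      \<Longrightarrow> component c \<cdot>\<^bsub>M\<^esub> FAr F \<sigma> = FAr G (rgt d \<sigma>) \<cdot>\<^bsub>M\<^esub> \<alpha> (lft d \<sigma>)"
proof -
  have "\<exists>!u. u \<in> hom M (FOb F c) (FOb G c) \<and> (\<forall>d\<in>Ob D. \<forall>\<sigma>\<in>hom C (FOb i d) c.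
      u \<cdot>\<^bsub>M\<^esub> FAr F \<sigma> = FAr G (rgt d \<sigma>) \<cdot>\<^bsub>M\<^esub> \<alpha> (lft d \<sigma>))"
  proof (rule dense_induced[OF dense_F F.cat_functor_axioms i.cat_functor_axioms c])
    show "FOb G c \<in> Ob M" using c by (rule G.FOb_Ob)
  next
    fix d \<sigma> assume d: "d \<in> Ob D" "\<sigma> \<in> hom C (FOb i d) c"
    show "FAr G (rgt d \<sigma>) \<cdot>\<^bsub>M\<^esub> \<alpha> (lft d \<sigma>) \<in> hom M (FOb F (FOb i d)) (FOb G c)"
      using \<alpha>_hom[OF d(1) mid_Ob[OF d] lft_hom[OF d]] G.FAr_hom[OF rgt_hom[OF d]]
      by (rule F.target.Comp_hom)
  qed (rule component_cocone)
  from theI'[OF this, folded component_def]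
  show "component c \<in> hom M (FOb F c) (FOb G c)"
    and "\<lbrakk>d \<in> Ob D; \<sigma> \<in> hom C (FOb i d) c\<rbrakk>
      \<Longrightarrow> component c \<cdot>\<^bsub>M\<^esub> FAr F \<sigma> = FAr G (rgt d \<sigma>) \<cdot>\<^bsub>M\<^esub> \<alpha> (lft d \<sigma>)"
    by blast+
qed

lemma push_facts:
  assumes d: "d \<in> Ob D" "\<sigma> \<in> hom C (FOb i d) x" and f: "f \<in> hom C x y"
  shows "f \<cdot>\<^bsub>C\<^esub> rgt d \<sigma> \<in> hom C (FOb i (mid d \<sigma>)) y"
    and "mid (mid d \<sigma>) (f \<cdot>\<^bsub>C\<^esub> rgt d \<sigma>) \<in> Ob D"
    and "lft (mid d \<sigma>) (f \<cdot>\<^bsub>C\<^esub> rgt d \<sigma>)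
      \<in> hom C (FOb i (mid d \<sigma>)) (FOb i (mid (mid d \<sigma>) (f \<cdot>\<^bsub>C\<^esub> rgt d \<sigma>)))"
    and "t (lft (mid d \<sigma>) (f \<cdot>\<^bsub>C\<^esub> rgt d \<sigma>))
      \<in> hom M (FOb G (FOb i (mid d \<sigma>))) (FOb G (FOb i (mid d \<sigma>)))"
proof -
  show fr: "f \<cdot>\<^bsub>C\<^esub> rgt d \<sigma> \<in> hom C (FOb i (mid d \<sigma>)) y"
    using rgt_hom[OF d] f by (rule i.target.Comp_hom)
  note m = mid_Ob[OF d]
  show m': "mid (mid d \<sigma>) (f \<cdot>\<^bsub>C\<^esub> rgt d \<sigma>) \<in> Ob D" using m fr by (rule mid_Ob)
  show l: "lft (mid d \<sigma>) (f \<cdot>\<^bsub>C\<^esub> rgt d \<sigma>)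
      \<in> hom C (FOb i (mid d \<sigma>)) (FOb i (mid (mid d \<sigma>) (f \<cdot>\<^bsub>C\<^esub> rgt d \<sigma>)))"
    using m fr by (rule lft_hom)
  show "t (lft (mid d \<sigma>) (f \<cdot>\<^bsub>C\<^esub> rgt d \<sigma>))
      \<in> hom M (FOb G (FOb i (mid d \<sigma>))) (FOb G (FOb i (mid d \<sigma>)))"
    using m m' l by (rule t_hom)
qed

text \<open>Here the comparison arrow \<open>i v\<close> has to move past a twist. After pushing along \<open>f\<close>, \<open>v\<close> is an
arrow over \<open>y\<close>; the naturality square of the factorization at it has the comparison arrows
\<open>i v\<close> and \<open>i w\<close> as sides, both in \<open>I\<close>, so the square axiom for \<open>t\<close> applies.\<close>

lemma twist_cocone:
  assumes d: "d \<in> Ob D" "d' \<in> Ob D" and \<sigma>: "\<sigma> \<in> hom C (FOb i d') x" and u: "u \<in> hom D d d'"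
    and f: "f \<in> hom C x y"
  defines "\<nu> \<equiv> \<lambda>d \<sigma>. FAr G (rgt d \<sigma>) \<cdot>\<^bsub>M\<^esub>
    (t (lft (mid d \<sigma>) (f \<cdot>\<^bsub>C\<^esub> rgt d \<sigma>)) \<cdot>\<^bsub>M\<^esub> FAr G (lft d \<sigma>))"
  shows "\<nu> d' \<sigma> \<cdot>\<^bsub>M\<^esub> FAr G (FAr i u) = \<nu> d (\<sigma> \<cdot>\<^bsub>C\<^esub> FAr i u)"
proof -
  let ?\<sigma> = "\<sigma> \<cdot>\<^bsub>C\<^esub> FAr i u"
  have iu: "FAr i u \<in> hom C (FOb i d) (FOb i d')" using u by (rule i.FAr_hom)
  then have \<sigma>u: "?\<sigma> \<in> hom C (FOb i d) x" using \<sigma> i.target.Comp_hom by blast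
  obtain v where v: "v \<in> hom D (mid d ?\<sigma>) (mid d' \<sigma>)" "FAr i v \<in> I"
      and vr: "rgt d ?\<sigma> = rgt d' \<sigma> \<cdot>\<^bsub>C\<^esub> FAr i v"
      and vl: "lft d' \<sigma> \<cdot>\<^bsub>C\<^esub> FAr i u = FAr i v \<cdot>\<^bsub>C\<^esub> lft d ?\<sigma>"
    using factor_natural[OF d \<sigma> u] by blast
  have iv: "FAr i v \<in> hom C (FOb i (mid d ?\<sigma>)) (FOb i (mid d' \<sigma>))" using v by (intro i.FAr_hom)
  note m = mid_Ob[OF d(1) \<sigma>u] mid_Ob[OF d(2) \<sigma>]
  note l = lft_hom[OF d(1) \<sigma>u] lft_hom[OF d(2) \<sigma>]
  note r = rgt_hom[OF d(1) \<sigma>u] rgt_hom[OF d(2) \<sigma>]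
  note p = push_facts[OF d(1) \<sigma>u f] and p' = push_facts[OF d(2) \<sigma> f]
  let ?t = "t (lft (mid d ?\<sigma>) (f \<cdot>\<^bsub>C\<^esub> rgt d ?\<sigma>))"
  let ?t' = "t (lft (mid d' \<sigma>) (f \<cdot>\<^bsub>C\<^esub> rgt d' \<sigma>))"
  have fv: "f \<cdot>\<^bsub>C\<^esub> rgt d' \<sigma> \<cdot>\<^bsub>C\<^esub> FAr i v = f \<cdot>\<^bsub>C\<^esub> rgt d ?\<sigma>"
    unfolding vr using iv r f by (simp add: hom_def arr)
  obtain w where w: "w \<in> hom D (mid (mid d ?\<sigma>) (f \<cdot>\<^bsub>C\<^esub> rgt d ?\<sigma>)) (mid (mid d' \<sigma>) (f \<cdot>\<^bsub>C\<^esub> rgt d' \<sigma>))"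
      "FAr i w \<in> I"
    "lft (mid d' \<sigma>) (f \<cdot>\<^bsub>C\<^esub> rgt d' \<sigma>) \<cdot>\<^bsub>C\<^esub> FAr i v
      = FAr i w \<cdot>\<^bsub>C\<^esub> lft (mid d ?\<sigma>) (f \<cdot>\<^bsub>C\<^esub> rgt d ?\<sigma>)"
    using factor_natural[OF m p'(1) v(1)] unfolding fv by blast
  have sq: "FAr G (FAr i v) \<cdot>\<^bsub>M\<^esub> ?t = ?t' \<cdot>\<^bsub>M\<^esub> FAr G (FAr i v)"
    using t_square[OF m p(2) p'(2) iv v(2) i.FAr_hom[OF w(1)] w(2) p(3) p'(3) w(3)[symmetric]] .
  have "\<nu> d' \<sigma> \<cdot>\<^bsub>M\<^esub> FAr G (FAr i u)
      = FAr G (rgt d' \<sigma>) \<cdot>\<^bsub>M\<^esub> (?t' \<cdot>\<^bsub>M\<^esub> FAr G (lft d' \<sigma> \<cdot>\<^bsub>C\<^esub> FAr i u))"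
    unfolding \<nu>_def using r iu l p'(4) by (simp add: hom_def arr)
  also have "\<dots> = FAr G (rgt d' \<sigma>) \<cdot>\<^bsub>M\<^esub> (?t' \<cdot>\<^bsub>M\<^esub> FAr G (FAr i v) \<cdot>\<^bsub>M\<^esub> FAr G (lft d ?\<sigma>))"
    unfolding vl using iv r l p'(4) by (simp add: hom_def arr)
  also have "\<dots> = \<nu> d ?\<sigma>"
    unfolding \<nu>_def sq[symmetric] vr[THEN arg_cong[where f = "FAr G"]]
    using iv r l p(4) by (simp add: hom_def arr)
  finally show ?thesis .
qed

lemma twist:
  assumes f: "f \<in> hom C x y"
  shows twist_hom: "twist f \<in> hom M (FOb G x) (FOb G x)"
    and twist_test: "\<lbrakk>d \<in> Ob D; \<sigma> \<in> hom C (FOb i d) x\<rbrakk> \<Longrightarrow>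
      twist f \<cdot>\<^bsub>M\<^esub> FAr G \<sigma> = FAr G (rgt d \<sigma>) \<cdot>\<^bsub>M\<^esub>
        (t (lft (mid d \<sigma>) (f \<cdot>\<^bsub>C\<^esub> rgt d \<sigma>)) \<cdot>\<^bsub>M\<^esub> FAr G (lft d \<sigma>))"
proof -
  have x: "x = Dom C f" "x \<in> Ob C" using f i.target.Dom_Ob by (auto simp: hom_def)
  have "\<exists>!u. u \<in> hom M (FOb G x) (FOb G x) \<and> (\<forall>d\<in>Ob D. \<forall>\<sigma>\<in>hom C (FOb i d) x.
      u \<cdot>\<^bsub>M\<^esub> FAr G \<sigma> = FAr G (rgt d \<sigma>) \<cdot>\<^bsub>M\<^esub>
        (t (lft (mid d \<sigma>) (f \<cdot>\<^bsub>C\<^esub> rgt d \<sigma>)) \<cdot>\<^bsub>M\<^esub> FAr G (lft d \<sigma>)))"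
  proof (rule dense_induced[OF dense_G G.cat_functor_axioms i.cat_functor_axioms x(2)])
    show "FOb G x \<in> Ob M" using x(2) by (rule G.FOb_Ob)
  next
    fix d \<sigma> assume d: "d \<in> Ob D" "\<sigma> \<in> hom C (FOb i d) x"
    show "FAr G (rgt d \<sigma>) \<cdot>\<^bsub>M\<^esub> (t (lft (mid d \<sigma>) (f \<cdot>\<^bsub>C\<^esub> rgt d \<sigma>)) \<cdot>\<^bsub>M\<^esub> FAr G (lft d \<sigma>))
        \<in> hom M (FOb G (FOb i d)) (FOb G x)"
      using push_facts(4)[OF d f] rgt_hom[OF d] lft_hom[OF d] by (simp add: hom_def arr)
  qed (rule twist_cocone[OF _ _ _ _ f])
  from theI'[OF this, unfolded x(1), folded twist_def, folded x(1)]
  show "twist f \<in> hom M (FOb G x) (FOb G x)"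
    and "\<lbrakk>d \<in> Ob D; \<sigma> \<in> hom C (FOb i d) x\<rbrakk> \<Longrightarrow>
      twist f \<cdot>\<^bsub>M\<^esub> FAr G \<sigma> = FAr G (rgt d \<sigma>) \<cdot>\<^bsub>M\<^esub>
        (t (lft (mid d \<sigma>) (f \<cdot>\<^bsub>C\<^esub> rgt d \<sigma>)) \<cdot>\<^bsub>M\<^esub> FAr G (lft d \<sigma>))"
    by blast+
qed

text \<open>This is the equation forced by the square axiom. Together with \<open>G_arrow_eqI\<close> below it is all
that the verification of the axioms needs to know about the new twist.\<close>

lemma twist_test_I:
  assumes f: "f \<in> hom C x y" and d: "d \<in> Ob D" "\<sigma> \<in> hom C (FOb i d) x" and \<sigma>: "\<sigma> \<in> I"
  shows "twist f \<cdot>\<^bsub>M\<^esub> FAr G \<sigma> = FAr G \<sigma> \<cdot>\<^bsub>M\<^esub> t (lft d (f \<cdot>\<^bsub>C\<^esub> \<sigma>))"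
  using twist_test[OF f d] push_facts(4)[OF d f] d
  by (simp add: mid_of_I[OF d \<sigma>] rgt_of_I[OF d \<sigma>] lft_of_I[OF d \<sigma>] arr) (simp add: hom_def arr)

text \<open>On \<open>\<sigma>\<close> the right-hand side produces the factorization of \<open>\<sigma>\<close> followed by that of
\<open>f \<cdot> rgt \<sigma>\<close>, and \<open>G (lft) \<cdot> t (lft) \<cdot> \<alpha>\<close> contracts to \<open>\<alpha>\<close> of a composite. By the push
rules this is the factorization of \<open>f \<cdot> \<sigma>\<close>, which is what the left-hand side produces.\<close>

lemma component_natural:
  assumes f: "f \<in> hom C x y"
  shows "component y \<cdot>\<^bsub>M\<^esub> FAr F f = FAr G f \<cdot>\<^bsub>M\<^esub> twist f \<cdot>\<^bsub>M\<^esub> component x"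
proof (rule dense_arrow_eqI[OF dense_F F.cat_functor_axioms i.cat_functor_axioms])
  show x: "x \<in> Ob C" using f i.target.Dom_Ob by (auto simp: hom_def)
  have y: "y \<in> Ob C" using f i.target.Cod_Ob by (auto simp: hom_def)
  note h = component_hom[OF x] component_hom[OF y] twist_hom[OF f]
  show "component y \<cdot>\<^bsub>M\<^esub> FAr F f \<in> hom M (FOb F x) (FOb G y)"
    "FAr G f \<cdot>\<^bsub>M\<^esub> twist f \<cdot>\<^bsub>M\<^esub> component x \<in> hom M (FOb F x) (FOb G y)"
    using h f by (simp_all add: hom_def arr)
  fix d \<sigma> assume d: "d \<in> Ob D" "\<sigma> \<in> hom C (FOb i d) x"
  let ?m = "mid d \<sigma>" and ?r = "rgt d \<sigma>" and ?l = "lft d \<sigma>"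
  let ?r' = "rgt ?m (f \<cdot>\<^bsub>C\<^esub> ?r)" and ?l' = "lft ?m (f \<cdot>\<^bsub>C\<^esub> ?r)"
  note p = push_facts[OF d f]
  note m = mid_Ob[OF d] and r = rgt_hom[OF d] and l = lft_hom[OF d]
  note r' = rgt_hom[OF m p(1)]
  note a = \<alpha>_hom[OF d(1) m l]
  have f\<sigma>: "f \<cdot>\<^bsub>C\<^esub> \<sigma> \<in> hom C (FOb i d) y" using d(2) f by (rule i.target.Comp_hom)
  have "FAr G f \<cdot>\<^bsub>M\<^esub> twist f \<cdot>\<^bsub>M\<^esub> component x \<cdot>\<^bsub>M\<^esub> FAr F \<sigma>
      = FAr G f \<cdot>\<^bsub>M\<^esub> (twist f \<cdot>\<^bsub>M\<^esub> (component x \<cdot>\<^bsub>M\<^esub> FAr F \<sigma>))"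
    using h f d by (simp add: hom_def arr)
  also have "\<dots> = FAr G f \<cdot>\<^bsub>M\<^esub> (twist f \<cdot>\<^bsub>M\<^esub> FAr G ?r \<cdot>\<^bsub>M\<^esub> \<alpha> ?l)"
    unfolding component_test[OF x d] using h r a by (simp add: hom_def arr)
  also have "\<dots> = FAr G (f \<cdot>\<^bsub>C\<^esub> ?r) \<cdot>\<^bsub>M\<^esub> (t ?l' \<cdot>\<^bsub>M\<^esub> \<alpha> ?l)"
    unfolding twist_test_I[OF f m r rgt_I[OF d]] using f r a p(4) by (simp add: hom_def arr)
  also have "\<dots> = FAr G (?r' \<cdot>\<^bsub>C\<^esub> ?l') \<cdot>\<^bsub>M\<^esub> (t ?l' \<cdot>\<^bsub>M\<^esub> \<alpha> ?l)"
    unfolding factor[OF m p(1)] ..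
  also have "\<dots> = FAr G ?r' \<cdot>\<^bsub>M\<^esub> (FAr G ?l' \<cdot>\<^bsub>M\<^esub> t ?l' \<cdot>\<^bsub>M\<^esub> \<alpha> ?l)"
    using r' p a by (simp add: hom_def arr)
  also have "\<dots> = FAr G (rgt d (f \<cdot>\<^bsub>C\<^esub> \<sigma>)) \<cdot>\<^bsub>M\<^esub> \<alpha> (lft d (f \<cdot>\<^bsub>C\<^esub> \<sigma>))"
    unfolding \<alpha>_post[OF d(1) m p(2) l p(3), symmetric] lft_push[OF d f] rgt_push[OF d f] ..
  also have "\<dots> = component y \<cdot>\<^bsub>M\<^esub> FAr F (f \<cdot>\<^bsub>C\<^esub> \<sigma>)"
    using component_test[OF y d(1) f\<sigma>] by simp
  also have "\<dots> = component y \<cdot>\<^bsub>M\<^esub> FAr F f \<cdot>\<^bsub>M\<^esub> FAr F \<sigma>"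
    using h f d by (simp add: hom_def arr)
  finally show "component y \<cdot>\<^bsub>M\<^esub> FAr F f \<cdot>\<^bsub>M\<^esub> FAr F \<sigma>
    = FAr G f \<cdot>\<^bsub>M\<^esub> twist f \<cdot>\<^bsub>M\<^esub> component x \<cdot>\<^bsub>M\<^esub> FAr F \<sigma>" by simp
qed

text \<open>Every \<open>\<sigma>\<close> factors through its right part, which lies in \<open>I\<close>, so that in density it suffices
to test on \<open>I\<close>.\<close>

lemma G_arrow_eqI:
  assumes c: "c \<in> Ob C" and a: "a \<in> hom M (FOb G c) n" and b: "b \<in> hom M (FOb G c) n"
    and eq: "\<And>d \<sigma>. \<lbrakk>d \<in> Ob D; \<sigma> \<in> hom C (FOb i d) c; \<sigma> \<in> I\<rbrakk>
      \<Longrightarrow> a \<cdot>\<^bsub>M\<^esub> FAr G \<sigma> = b \<cdot>\<^bsub>M\<^esub> FAr G \<sigma>"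
  shows "a = b"
proof (rule dense_arrow_eqI[OF dense_G G.cat_functor_axioms i.cat_functor_axioms c a b])
  fix d \<sigma> assume d: "d \<in> Ob D" "\<sigma> \<in> hom C (FOb i d) c"
  note l = lft_hom[OF d] and r = rgt_hom[OF d]
  have split: "e \<cdot>\<^bsub>M\<^esub> FAr G \<sigma> = e \<cdot>\<^bsub>M\<^esub> FAr G (rgt d \<sigma>) \<cdot>\<^bsub>M\<^esub> FAr G (lft d \<sigma>)"
    if "e \<in> hom M (FOb G c) n" for e
    using factor[OF d, THEN arg_cong[where f = "FAr G"]] that l r by (simp add: hom_def arr)
  show "a \<cdot>\<^bsub>M\<^esub> FAr G \<sigma> = b \<cdot>\<^bsub>M\<^esub> FAr G \<sigma>"
    using split[OF a] split[OF b] eq[OF mid_Ob[OF d] r rgt_I[OF d]] by simp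
qed

lemma I_comp: "\<lbrakk>f \<in> hom C x y; g \<in> hom C y z; f \<in> I; g \<in> I\<rbrakk> \<Longrightarrow> g \<cdot>\<^bsub>C\<^esub> f \<in> I"
  using wide by (simp add: wide_subcategory_def hom_def)

lemma twist_of_I:
  assumes f: "f \<in> hom C x y" and fI: "f \<in> I"
  shows "twist f = Ide M (FOb G x)"
proof (rule G_arrow_eqI)
  show x: "x \<in> Ob C" using f i.target.Dom_Ob by (auto simp: hom_def)
  show "twist f \<in> hom M (FOb G x) (FOb G x)" using f by (rule twist_hom)
  show "Ide M (FOb G x) \<in> hom M (FOb G x) (FOb G x)" using x by (intro F.target.Ide_hom G.FOb_Ob)
  fix d \<sigma> assume d: "d \<in> Ob D" "\<sigma> \<in> hom C (FOb i d) x" and \<sigma>: "\<sigma> \<in> I"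
  have f\<sigma>: "f \<cdot>\<^bsub>C\<^esub> \<sigma> \<in> hom C (FOb i d) y" using d(2) f by (rule i.target.Comp_hom)
  have "lft d (f \<cdot>\<^bsub>C\<^esub> \<sigma>) = Ide C (FOb i d)"
    using lft_of_I[OF d(1) f\<sigma>] I_comp[OF d(2) f \<sigma> fI] by blast
  moreover have "t (Ide C (FOb i d)) = Ide M (FOb G (FOb i d))"
    using t_of_I[OF d(1) d(1) i.target.Ide_hom] d(1) i.FOb_Ob wide
    by (simp add: wide_subcategory_def)
  ultimately show "twist f \<cdot>\<^bsub>M\<^esub> FAr G \<sigma> = Ide M (FOb G x) \<cdot>\<^bsub>M\<^esub> FAr G \<sigma>"
    using twist_test_I[OF f d \<sigma>] d by (simp add: hom_def arr)
qed

text \<open>Now \<open>f \<cdot> rgt \<sigma>\<close> is in \<open>I\<close>, so its left part, by which \<open>lft (f \<cdot> \<sigma>)\<close> and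
\<open>lft \<sigma>\<close> differ, is an identity.\<close>

lemma lft_push_I:
  assumes d: "d \<in> Ob D" "\<sigma> \<in> hom C (FOb i d) x" and f: "f \<in> hom C x y" "f \<in> I"
  shows "lft d (f \<cdot>\<^bsub>C\<^esub> \<sigma>) = lft d \<sigma>"
proof -
  have "lft (mid d \<sigma>) (f \<cdot>\<^bsub>C\<^esub> rgt d \<sigma>) = Ide C (FOb i (mid d \<sigma>))"
    using lft_of_I[OF mid_Ob[OF d] push_facts(1)[OF d f(1)]]
      I_comp[OF rgt_hom[OF d] f(1) rgt_I[OF d] f(2)] by blast
  then show ?thesis using lft_push[OF d f(1)] lft_hom[OF d] i.target.Ide_Comp by simp
qed

text \<open>On \<open>\<sigma>\<close> in \<open>I\<close> the two sides involve the twists of the left parts of \<open>g1 \<cdot> \<sigma>\<close> and of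
\<open>g2 \<cdot> f1 \<cdot> \<sigma> = f2 \<cdot> g1 \<cdot> \<sigma>\<close>. These left parts agree as \<open>f2\<close> is in \<open>I\<close>.\<close>

lemma twist_square:
  assumes f1: "f1 \<in> hom C a a'" "f1 \<in> I" and f2: "f2 \<in> hom C b b'" "f2 \<in> I"
    and g1: "g1 \<in> hom C a b" and g2: "g2 \<in> hom C a' b'"
    and eq: "f2 \<cdot>\<^bsub>C\<^esub> g1 = g2 \<cdot>\<^bsub>C\<^esub> f1"
  shows "FAr G f1 \<cdot>\<^bsub>M\<^esub> twist g1 = twist g2 \<cdot>\<^bsub>M\<^esub> FAr G f1"
proof (rule G_arrow_eqI)
  show "a \<in> Ob C" using f1 i.target.Dom_Ob by (auto simp: hom_def)
  note h = twist_hom[OF g1] twist_hom[OF g2]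
  show "FAr G f1 \<cdot>\<^bsub>M\<^esub> twist g1 \<in> hom M (FOb G a) (FOb G a')"
    "twist g2 \<cdot>\<^bsub>M\<^esub> FAr G f1 \<in> hom M (FOb G a) (FOb G a')"
    using h f1 by (simp_all add: hom_def arr)
  fix d \<sigma> assume d: "d \<in> Ob D" "\<sigma> \<in> hom C (FOb i d) a" and \<sigma>: "\<sigma> \<in> I"
  have g\<sigma>: "g1 \<cdot>\<^bsub>C\<^esub> \<sigma> \<in> hom C (FOb i d) b" using d(2) g1 by (rule i.target.Comp_hom)
  have f\<sigma>: "f1 \<cdot>\<^bsub>C\<^esub> \<sigma> \<in> hom C (FOb i d) a'" using d(2) f1(1) by (rule i.target.Comp_hom)
  have "g2 \<cdot>\<^bsub>C\<^esub> (f1 \<cdot>\<^bsub>C\<^esub> \<sigma>) = f2 \<cdot>\<^bsub>C\<^esub> (g1 \<cdot>\<^bsub>C\<^esub> \<sigma>)"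
    using i.target.Comp_assoc[OF d(2) f1(1) g2] i.target.Comp_assoc[OF d(2) g1 f2(1)] eq by simp
  then have lft_eq: "lft d (g2 \<cdot>\<^bsub>C\<^esub> (f1 \<cdot>\<^bsub>C\<^esub> \<sigma>)) = lft d (g1 \<cdot>\<^bsub>C\<^esub> \<sigma>)"
    using lft_push_I[OF d(1) g\<sigma> f2] by simp
  have t: "t (lft d (g1 \<cdot>\<^bsub>C\<^esub> \<sigma>)) \<in> hom M (FOb G (FOb i d)) (FOb G (FOb i d))"
    using d(1) mid_Ob[OF d(1) g\<sigma>] lft_hom[OF d(1) g\<sigma>] by (rule t_hom)
  have "FAr G f1 \<cdot>\<^bsub>M\<^esub> twist g1 \<cdot>\<^bsub>M\<^esub> FAr G \<sigma> = FAr G f1 \<cdot>\<^bsub>M\<^esub> (twist g1 \<cdot>\<^bsub>M\<^esub> FAr G \<sigma>)"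
    using h f1 d by (simp add: hom_def arr)
  also have "\<dots> = FAr G (f1 \<cdot>\<^bsub>C\<^esub> \<sigma>) \<cdot>\<^bsub>M\<^esub> t (lft d (g1 \<cdot>\<^bsub>C\<^esub> \<sigma>))"
    unfolding twist_test_I[OF g1 d \<sigma>] using t f1 d by (simp add: hom_def arr)
  also have "\<dots> = twist g2 \<cdot>\<^bsub>M\<^esub> FAr G (f1 \<cdot>\<^bsub>C\<^esub> \<sigma>)"
    using twist_test_I[OF g2 d(1) f\<sigma> I_comp[OF d(2) f1(1) \<sigma> f1(2)]] lft_eq by simp
  also have "\<dots> = twist g2 \<cdot>\<^bsub>M\<^esub> FAr G f1 \<cdot>\<^bsub>M\<^esub> FAr G \<sigma>"
    using h f1 d by (simp add: hom_def arr)
  finally show "FAr G f1 \<cdot>\<^bsub>M\<^esub> twist g1 \<cdot>\<^bsub>M\<^esub> FAr G \<sigma> = twist g2 \<cdot>\<^bsub>M\<^esub> FAr G f1 \<cdot>\<^bsub>M\<^esub> FAr G \<sigma>" .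
qed

lemma component_image:
  assumes d: "d \<in> Ob D"
  shows "component (FOb i d) = \<alpha> (Ide C (FOb i d))"
proof -
  have x: "FOb i d \<in> Ob C" using d by (rule i.FOb_Ob)
  note h = i.target.Ide_hom[OF x]
  have I: "Ide C (FOb i d) \<in> I" using wide x by (simp add: wide_subcategory_def)
  show ?thesis
    using component_test[OF x d h] component_hom[OF x] \<alpha>_hom[OF d d h] x
    by (simp add: rgt_of_I[OF d h I] lft_of_I[OF d h I] hom_def arr)
qed

lemma extends_\<alpha>:
  assumes d: "d \<in> Ob D" "d' \<in> Ob D" and f: "f \<in> hom C (FOb i d) (FOb i d')"
  shows "component (FOb i d') \<cdot>\<^bsub>M\<^esub> FAr F f = \<alpha> f"
  using \<alpha>_pre[OF d(1,2,2) f i.target.Ide_hom] i.FOb_Ob[OF d(2)] i.target.Ide_Comp[OF f]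
  by (simp add: component_image[OF d(2)])

text \<open>Testing on the identity of \<open>i d\<close> gives \<open>twist f = t (lft f)\<close>. The square axiom for \<open>t\<close>, with
an identity and \<open>rgt f\<close> as its sides in \<open>I\<close>, identifies this with \<open>t f\<close>.\<close>

lemma extends_t:
  assumes d: "d \<in> Ob D" "d' \<in> Ob D" and f: "f \<in> hom C (FOb i d) (FOb i d')"
  shows "twist f = t f"
proof -
  have x: "FOb i d \<in> Ob C" using d(1) by (rule i.FOb_Ob)
  note h = i.target.Ide_hom[OF x]
  have I: "Ide C (FOb i d) \<in> I" using wide x by (simp add: wide_subcategory_def)
  note m = mid_Ob[OF d(1) f] and l = lft_hom[OF d(1) f]
  have "twist f = t (lft d f)"
    using twist_test_I[OF f d(1) h I] twist_hom[OF f] t_hom[OF d(1) m l] x f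
    by (simp add: hom_def arr)
  also have "\<dots> = t f"
    using t_square[OF d(1,1) m d(2) h I rgt_hom[OF d(1) f] rgt_I[OF d(1) f] l f]
      factor[OF d(1) f] t_hom[OF d(1) m l] t_hom[OF d f] x f
    by (simp add: hom_def arr)
  finally show ?thesis .
qed

lemma twisted_nat_trans_extension:
  "twisted_nat_trans C M I F G (\<lambda>f. component (Cod C f) \<cdot>\<^bsub>M\<^esub> FAr F f) twist"
proof (rule twisted_nat_transI_components[OF F.cat_functor_axioms G.cat_functor_axioms])
  have I: "f \<in> Ar C" if "f \<in> I" for f using that wide by (auto simp: wide_subcategory_def)
  show "component c \<in> hom M (FOb F c) (FOb G c)" if "c \<in> Ob C" for c
    using that by (rule component_hom)
  fix f
  show "f \<in> Ar C \<Longrightarrow> twist f \<in> hom M (FOb G (Dom C f)) (FOb G (Dom C f))"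
    and "f \<in> Ar C \<Longrightarrow>
      component (Cod C f) \<cdot>\<^bsub>M\<^esub> FAr F f = FAr G f \<cdot>\<^bsub>M\<^esub> twist f \<cdot>\<^bsub>M\<^esub> component (Dom C f)"
    and "f \<in> I \<Longrightarrow> twist f = Ide M (FOb G (Dom C f))"
    using I twist_hom[of f "Dom C f" "Cod C f"] component_natural[of f "Dom C f" "Cod C f"]
      twist_of_I[of f "Dom C f" "Cod C f"] by (auto simp: hom_def)
  fix f1 f2 g1 g2
  assume *: "f1 \<in> I" "f2 \<in> I" "g1 \<in> Ar C" "g2 \<in> Ar C" "Cod C g1 = Dom C f2"
    "Cod C f1 = Dom C g2" "Dom C g1 = Dom C f1" "f2 \<cdot>\<^bsub>C\<^esub> g1 = g2 \<cdot>\<^bsub>C\<^esub> f1"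
  have "Cod C g2 = Cod C f2"
    using * I i.target.Cod_Comp[of g1 f2] i.target.Cod_Comp[of f1 g2] by simp
  then show "FAr G f1 \<cdot>\<^bsub>M\<^esub> twist g1 = twist g2 \<cdot>\<^bsub>M\<^esub> FAr G f1"
    using twist_square[of f1 "Dom C f1" "Cod C f1" f2 "Dom C f2" "Cod C f2" g1 g2] * I
    by (simp add: hom_def)
qed

end

theorem theorem2p3:
  fixes C :: "('co, 'ca) cat" and D :: "('do, 'da) cat" and M :: "('mo, 'ma) cat"
    and I :: "'ca set"
    and F G :: "('co, 'ca, 'mo, 'ma) fctr" and i :: "('do, 'da, 'co, 'ca) fctr"
    and \<alpha> t :: "'ca \<Rightarrow> 'ma"
  assumes "category C" and "category D" and "category M"
    and "wide_subcategory C I"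
    and "cat_functor C M F" and "cat_functor C M G" and "cat_functor D C i"
    and "full_functor D C i"
    and "I_dense_for D C M I i F" and "I_dense_for D C M I i G"
    and "twisted_nat_trans (image_cat D C i) M (I \<inter> Ar (image_cat D C i)) F G \<alpha> t"
  shows "\<exists>\<alpha>' t'. twisted_nat_trans C M I F G \<alpha>' t' \<and>
    (\<forall>f\<in>Ar (image_cat D C i). \<alpha>' f = \<alpha> f \<and> t' f = t f)"
proof -
  obtain mid lft rgt where "over_factorization D C i I mid lft rgt"
    using I_dense_for_factorization assms by blast
  then interpret twisted_extension D C i I mid lft rgt M F G \<alpha> t
    using assms by (simp add: twisted_extension_def twisted_extension_axioms_def I_dense_for_def)
  have "component (Cod C f) \<cdot>\<^bsub>M\<^esub> FAr F f = \<alpha> f \<and> twist f = t f"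
    if f: "f \<in> Ar (image_cat D C i)" for f
  proof -
    obtain d d' where d: "d \<in> Ob D" "d' \<in> Ob D" and f': "f \<in> hom C (FOb i d) (FOb i d')"
      using f unfolding Ar_image_cat[OF full] by (auto simp: hom_def)
    then have "Cod C f = FOb i d'" by (simp add: hom_def)
    then show ?thesis using extends_\<alpha>[OF d f'] extends_t[OF d f'] by simp
  qed
  then show ?thesis using twisted_nat_trans_extension by blast
qed

end
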